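(* Let $B$ be a finitely generated, perfect group and let $\mathcal{S}=((\Omega_i)_{i\in\mathbb{N}},(\phi_i)_{i\geq2})$ be a flexible $B$-telescope such that each $\Omega_i$ is a finitely generated non-abelian simple group. If the head $Q_{\mathcal{S}}$ is simple, then the following are equivalent for a subgroup $N\leq G_{\mathcal{S}}$: (1) $N$ is a finitely generated normal subgroup of $G_{\mathcal{S}}$. (2) $N$ is a direct factor of $G_{\mathcal{S}}$.
   Context: Notation: $g^h=h^{-1}gh$, $[g,h]=ghg^{-1}h^{-1}$, $\mathbb{N}=\{1,2,\dots\}$. For a group $B$, a $B$-telescope $\mathcal{S}=((\Omega_i)_{i\in\mathbb{N}},(\phi_i)_{i\geq2})$ consists of a directed system of groups $\Omega_i$ with homomorphisms $\iota_{i,j}\colon\Omega_i\to\Omega_j$ for $i<j$ (with $\iota_{j,k}\circ\iota_{i,j}=\iota_{i,k}$, and $\iota_{i,i}=\mathrm{id}$), together with homomorphisms $\phi_i\colon B\to\Omega_i$ for $i\geq2$ with images $B_i=\phi_i(B)$, such that $\Omega_i=\langle hB_ih^{-1}\mid h\in\iota_{i-1,i}(\Omega_{i-1})\rangle$ for all $i\geq2$ and $[\iota_{i,j}(B_i),B_j]=1$ for all $2\leq i<j$. Write $B_{i,j}=\iota_{i,j}(B_i)$. $\mathcal{S}$ is flexible if for all $i\in\mathbb{N}$ there is $\alpha_i\in\Omega_i$ such that, with $\alpha_{i,j}=\iota_{i,j}(\alpha_i)$: (F1) $[\alpha_{i,i+1},B_{i+1}]=1$ for all $i\geq1$; (F2)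 $[B_{k,m}^{\alpha_{i,m}},B_{\ell,m}]=1$ for all $k,\ell\geq i+2$ and $m\geq k,\ell$; (F3) $[B_{k,m}^{\alpha_{i,m}},B_{\ell,m}^{\alpha_{j,m}}]=1$ for all $k\geq i+2$, $\ell\geq j+2$, $i>j$ and $m\geq k,\ell$. Let $P_{\mathcal{S}}=\prod_{i=1}^\infty\Omega_i$ with projections $\pi_i$. Let $\Delta_i\colon\Omega_i\to P_{\mathcal{S}}$, $\omega\mapsto(1,\dots,1,\omega,\iota_{i,i+1}(\omega),\iota_{i,i+2}(\omega),\dots)$ with $i-1$ leading $1$'s. For $g\in B$ let $\tilde g^{[1]}\in P_{\mathcal{S}}$ have $\pi_1(\tilde g^{[1]})=1$ and $\pi_i(\tilde g^{[1]})=\prod_{k=2}^i\iota_{k,i}(\phi_k(g))$ for $i>1$ (the factors commute); $C^{[1]}=\{\tilde g^{[1]}\mid g\in B\}$. The group of $\mathcal{S}$ is $G_{\mathcal{S}}=\langle\Delta_1(\Omega_1),C^{[1]}\rangle$, the huge group is $\widetilde G_{\mathcal{S}}=\langle\bigcup_{i\geq1}\Delta_i(\Omega_i)\cup C^{[1]}\rangle$; the latter contains $\bigoplus_{i=1}^\infty\Omega_i$ as a normal subgroup and the head is $Q_{\mathcal{S}}=\widetilde G_{\mathcal{S}}/\bigoplus_{i=1}^\infty\Omega_i$. (If $\mathcal{S}$ is flexible and $B$ is perfect, then $G_{\mathcal{S}}=\widetilde G_{\mathcal{S}}$.) *)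

theory Defs
  imports "HOL-Algebra.Product_Groups"
begin

(* The library locale simple_group requires "order G > 1", where order is the (nat-valued)
   cardinality of the carrier and hence 0 on infinite carriers. It therefore only covers finite
   groups, whereas the simple groups considered here are typically infinite. *)
definition simple_grp :: "('a, 'm) monoid_scheme \<Rightarrow> bool" where
  "simple_grp G \<longleftrightarrow>
     group G \<and> carrier G \<noteq> {\<one>\<^bsub>G\<^esub>} \<and> (\<forall>N. N \<lhd> G \<longrightarrow> N = carrier G \<or> N = {\<one>\<^bsub>G\<^esub>})"

definition perfect_group :: "('a, 'm) monoid_scheme \<Rightarrow> bool" where
  "perfect_group G \<longleftrightarrow> group G \<and> derived G (carrier G) = carrier G"

(* Finite generation of a subgroup H of G; for the group itself take H = carrier G. *)
definition finitely_generated_in :: "('a, 'm) monoid_scheme \<Rightarrow> 'a set \<Rightarrow> bool" where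
  "finitely_generated_in G H \<longleftrightarrow> (\<exists>S. finite S \<and> S \<subseteq> H \<and> generate G S = H)"

definition direct_factor :: "('a, 'm) monoid_scheme \<Rightarrow> 'a set \<Rightarrow> bool" where
  "direct_factor G N \<longleftrightarrow>
     (\<exists>M. N \<lhd> G \<and> M \<lhd> G \<and> N \<inter> M = {\<one>\<^bsub>G\<^esub>} \<and> N <#>\<^bsub>G\<^esub> M = carrier G)"

(* [S, T], with the convention [g, h] = g h g^-1 h^-1 *)
definition commutator_subgroup :: "('a, 'm) monoid_scheme \<Rightarrow> 'a set \<Rightarrow> 'a set \<Rightarrow> 'a set" where
  "commutator_subgroup G S T =
     generate G {g \<otimes>\<^bsub>G\<^esub> h \<otimes>\<^bsub>G\<^esub> inv\<^bsub>G\<^esub> g \<otimes>\<^bsub>G\<^esub> inv\<^bsub>G\<^esub> h | g h. g \<in> S \<and> h \<in> T}"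

(* S^h, with the convention g^h = h^-1 g h *)
definition conj_set :: "('a, 'm) monoid_scheme \<Rightarrow> 'a set \<Rightarrow> 'a \<Rightarrow> 'a set" where
  "conj_set G S h = (\<lambda>g. inv\<^bsub>G\<^esub> h \<otimes>\<^bsub>G\<^esub> g \<otimes>\<^bsub>G\<^esub> h) ` S"

(* B_{i,j}, the image of B in Omega_j through Omega_i; in a telescope, B_{i,i} = B_i. *)
definition tel_image ::
  "('b, 'n) monoid_scheme \<Rightarrow> (nat \<Rightarrow> nat \<Rightarrow> 'a \<Rightarrow> 'a) \<Rightarrow> (nat \<Rightarrow> 'b \<Rightarrow> 'a) \<Rightarrow> nat \<Rightarrow> nat \<Rightarrow> 'a set" where
  "tel_image B \<iota> \<phi> i j = \<iota> i j ` \<phi> i ` carrier B"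

(* The natural numbers indexing the system start at 1: the values of \<Omega> 0, of \<phi> 0 and \<phi> 1, and of
   \<iota> i j for i = 0 or i > j are irrelevant. *)
locale telescope =
  fixes B :: "('b, 'n) monoid_scheme"
    and \<Omega> :: "nat \<Rightarrow> ('a, 'm) monoid_scheme"
    and \<iota> :: "nat \<Rightarrow> nat \<Rightarrow> 'a \<Rightarrow> 'a"
    and \<phi> :: "nat \<Rightarrow> 'b \<Rightarrow> 'a"
  assumes group_B: "group B"
    and group_\<Omega>: "1 \<le> i \<Longrightarrow> group (\<Omega> i)"
    and \<iota>_hom: "\<lbrakk>1 \<le> i; i < j\<rbrakk> \<Longrightarrow> \<iota> i j \<in> hom (\<Omega> i) (\<Omega> j)"
    and \<iota>_id: "\<lbrakk>1 \<le> i; x \<in> carrier (\<Omega> i)\<rbrakk> \<Longrightarrow> \<iota> i i x = x"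
    and \<iota>_comp: "\<lbrakk>1 \<le> i; i < j; j < k; x \<in> carrier (\<Omega> i)\<rbrakk> \<Longrightarrow> \<iota> j k (\<iota> i j x) = \<iota> i k x"
    and \<phi>_hom: "2 \<le> i \<Longrightarrow> \<phi> i \<in> hom B (\<Omega> i)"
    and \<Omega>_generated: "2 \<le> i \<Longrightarrow>
      carrier (\<Omega> i) =
        generate (\<Omega> i) {h \<otimes>\<^bsub>\<Omega> i\<^esub> b \<otimes>\<^bsub>\<Omega> i\<^esub> inv\<^bsub>\<Omega> i\<^esub> h | h b.
          h \<in> \<iota> (i - 1) i ` carrier (\<Omega> (i - 1)) \<and> b \<in> \<phi> i ` carrier B}"
    and images_commute: "\<lbrakk>2 \<le> i; i < j\<rbrakk> \<Longrightarrow>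
      commutator_subgroup (\<Omega> j) (tel_image B \<iota> \<phi> i j) (\<phi> j ` carrier B) = {\<one>\<^bsub>\<Omega> j\<^esub>}"

locale flexible_telescope = telescope +
  assumes flexible: "\<exists>\<alpha>.
    (\<forall>i\<ge>1. \<alpha> i \<in> carrier (\<Omega> i)) \<and>
    (\<forall>i\<ge>1. commutator_subgroup (\<Omega> (i + 1)) {\<iota> i (i + 1) (\<alpha> i)} (\<phi> (i + 1) ` carrier B)
              = {\<one>\<^bsub>\<Omega> (i + 1)\<^esub>}) \<and>
    (\<forall>i\<ge>1. \<forall>k\<ge>i + 2. \<forall>l\<ge>i + 2. \<forall>m\<ge>max k l.
       commutator_subgroup (\<Omega> m)
         (conj_set (\<Omega> m) (tel_image B \<iota> \<phi> k m) (\<iota> i m (\<alpha> i)))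
         (tel_image B \<iota> \<phi> l m) = {\<one>\<^bsub>\<Omega> m\<^esub>}) \<and>
    (\<forall>j\<ge>1. \<forall>i>j. \<forall>k\<ge>i + 2. \<forall>l\<ge>j + 2. \<forall>m\<ge>max k l.
       commutator_subgroup (\<Omega> m)
         (conj_set (\<Omega> m) (tel_image B \<iota> \<phi> k m) (\<iota> i m (\<alpha> i)))
         (conj_set (\<Omega> m) (tel_image B \<iota> \<phi> l m) (\<iota> j m (\<alpha> j))) = {\<one>\<^bsub>\<Omega> m\<^esub>})"

abbreviation tel_product :: "(nat \<Rightarrow> ('a, 'm) monoid_scheme) \<Rightarrow> (nat \<Rightarrow> 'a) monoid" where
  "tel_product \<Omega> \<equiv> product_group {1..} \<Omega>"

definition tel_diag ::
  "(nat \<Rightarrow> ('a, 'm) monoid_scheme) \<Rightarrow> (nat \<Rightarrow> nat \<Rightarrow> 'a \<Rightarrow> 'a) \<Rightarrow> nat \<Rightarrow> 'a \<Rightarrow> (nat \<Rightarrow> 'a)" where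
  "tel_diag \<Omega> \<iota> i \<omega> = (\<lambda>j\<in>{1..}. if j < i then \<one>\<^bsub>\<Omega> j\<^esub> else \<iota> i j \<omega>)"

(* The i-th coordinate is the product over k = 2, ..., i, taken in increasing order of k since
   \<Omega> i is not commutative (in a telescope the factors commute); it is empty for i = 1. *)
definition tel_tilde ::
  "(nat \<Rightarrow> ('a, 'm) monoid_scheme) \<Rightarrow> (nat \<Rightarrow> nat \<Rightarrow> 'a \<Rightarrow> 'a) \<Rightarrow> (nat \<Rightarrow> 'b \<Rightarrow> 'a) \<Rightarrow> 'b \<Rightarrow> (nat \<Rightarrow> 'a)" where
  "tel_tilde \<Omega> \<iota> \<phi> g =
     (\<lambda>i\<in>{1..}. foldr (\<lambda>k x. \<iota> k i (\<phi> k g) \<otimes>\<^bsub>\<Omega> i\<^esub> x) [2..<i + 1] \<one>\<^bsub>\<Omega> i\<^esub>)"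

definition telescope_group ::
  "('b, 'n) monoid_scheme \<Rightarrow> (nat \<Rightarrow> ('a, 'm) monoid_scheme) \<Rightarrow> (nat \<Rightarrow> nat \<Rightarrow> 'a \<Rightarrow> 'a)
     \<Rightarrow> (nat \<Rightarrow> 'b \<Rightarrow> 'a) \<Rightarrow> (nat \<Rightarrow> 'a) monoid" where
  "telescope_group B \<Omega> \<iota> \<phi> =
     subgroup_generated (tel_product \<Omega>)
       (tel_diag \<Omega> \<iota> 1 ` carrier (\<Omega> 1) \<union> tel_tilde \<Omega> \<iota> \<phi> ` carrier B)"

definition telescope_huge_group ::
  "('b, 'n) monoid_scheme \<Rightarrow> (nat \<Rightarrow> ('a, 'm) monoid_scheme) \<Rightarrow> (nat \<Rightarrow> nat \<Rightarrow> 'a \<Rightarrow> 'a)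
     \<Rightarrow> (nat \<Rightarrow> 'b \<Rightarrow> 'a) \<Rightarrow> (nat \<Rightarrow> 'a) monoid" where
  "telescope_huge_group B \<Omega> \<iota> \<phi> =
     subgroup_generated (tel_product \<Omega>)
       ((\<Union>i\<in>{1..}. tel_diag \<Omega> \<iota> i ` carrier (\<Omega> i)) \<union> tel_tilde \<Omega> \<iota> \<phi> ` carrier B)"

definition telescope_head ::
  "('b, 'n) monoid_scheme \<Rightarrow> (nat \<Rightarrow> ('a, 'm) monoid_scheme) \<Rightarrow> (nat \<Rightarrow> nat \<Rightarrow> 'a \<Rightarrow> 'a)
     \<Rightarrow> (nat \<Rightarrow> 'b \<Rightarrow> 'a) \<Rightarrow> (nat \<Rightarrow> 'a) set monoid" where
  "telescope_head B \<Omega> \<iota> \<phi> =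
     telescope_huge_group B \<Omega> \<iota> \<phi> Mod carrier (sum_group {1..} \<Omega>)"

end

theory Submission
  imports Defs "HOL-Algebra.Zassenhaus"
begin

text \<open>
  Write \<open>G\<close> for the telescope group and \<open>D\<close> for the direct sum of the \<open>\<Omega> i\<close>, a normal subgroup of
  every subgroup of the full product that contains it.

  Flexibility and perfectness of \<open>B\<close> put the whole huge group inside \<open>G\<close>: conjugating the
  \<open>B\<close>-diagonal above level \<open>r\<close> by the diagonal copy of \<open>\<alpha> r\<close> fixes its first level and moves the
  higher ones to elements that commute with them, so commutators with the unconjugated diagonal only
  see the first level. As \<open>B\<close> is generated by commutators, this isolates the diagonal copy of \<open>\<phi> (r + 1) B\<close>, whose
  conjugates generate the diagonal copy of \<open>\<Omega> (r + 1)\<close>; one climbs from level to level in this way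
  (\<open>diag_of_commutator_in_subgroup\<close>, \<open>diag_and_tail_in_subgroup\<close>). Consecutive diagonals differ by a
  single coordinate, so \<open>G\<close> contains \<open>D\<close> and \<open>G / D\<close> is the head.

  Let \<open>N\<close> be normal in \<open>G\<close> and let \<open>J\<close> be the set of coordinates at which \<open>N\<close> is not trivial. For
  \<open>i \<in> J\<close> the group \<open>N\<close> contains the factor \<open>\<Omega> i\<close>: a nontrivial coordinate is not central, so it has
  nontrivial commutators with \<open>\<Omega> i\<close>, and these generate \<open>\<Omega> i\<close> by simplicity
  (\<open>single_in_normal_if_support\<close>). Since the head is simple, \<open>N \<le> D\<close> or \<open>N D = G\<close>. In the first case
  a finitely generated \<open>N\<close> has finite \<open>J\<close>, and the elements of \<open>G\<close> that vanish on \<open>J\<close> form a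
  complement. In the second case the elements of \<open>D\<close> that vanish on \<open>J\<close> do. Both cases are
  instances of \<open>direct_factorI\<close>.

  Conversely, \<open>G\<close> is finitely generated because \<open>\<Omega> 1\<close> and \<open>B\<close> are, and a direct factor of a
  finitely generated group is a quotient of it, hence finitely generated
  (\<open>finitely_generated_if_normal_complement\<close>).
\<close>

section \<open>Commutators and commuting elements\<close>

lemma (in group) commutator_one_iff:
  assumes "x \<in> carrier G" "y \<in> carrier G"
  shows "x \<otimes> y \<otimes> inv x \<otimes> inv y = \<one> \<longleftrightarrow> x \<otimes> y = y \<otimes> x"
proof -
  have "x \<otimes> y \<otimes> inv x \<otimes> inv y = (x \<otimes> y) \<otimes> inv (y \<otimes> x)"
    using assms by (simp add: inv_mult_group m_assoc)
  then show ?thesis using assms by (metis inv_closed inv_equality inv_inv m_closed r_inv)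
qed

lemma (in group) commutator_subgroup_trivialD:
  assumes "commutator_subgroup G S T = {\<one>}" "s \<in> S" "t \<in> T" "s \<in> carrier G" "t \<in> carrier G"
  shows "s \<otimes> t = t \<otimes> s"
proof -
  have "s \<otimes> t \<otimes> inv s \<otimes> inv t \<in> commutator_subgroup G S T"
    unfolding commutator_subgroup_def by (rule generate.incl) (use assms in blast)
  then show ?thesis using assms commutator_one_iff by simp
qed

text \<open>
  Moving the conjugation from \<open>p\<close> to \<open>q\<close> makes it possible to show that a conjugate of one product
  commutes with another product by treating the factors of either product one at a time.
\<close>
lemma (in group) commute_conj_iff:
  assumes "a \<in> carrier G" "p \<in> carrier G" "q \<in> carrier G"
  shows "(inv a \<otimes> p \<otimes> a) \<otimes> q = q \<otimes> (inv a \<otimes> p \<otimes> a) \<longleftrightarrow>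
    (a \<otimes> q \<otimes> inv a) \<otimes> p = p \<otimes> (a \<otimes> q \<otimes> inv a)"
proof -
  have can: "a \<otimes> (inv a \<otimes> u) = u" if "u \<in> carrier G" for u
    using assms that by (simp flip: m_assoc)
  have 1: "a \<otimes> ((inv a \<otimes> p \<otimes> a) \<otimes> q) \<otimes> inv a = p \<otimes> (a \<otimes> q \<otimes> inv a)"
    using assms by (simp add: m_assoc can)
  have 2: "a \<otimes> (q \<otimes> (inv a \<otimes> p \<otimes> a)) \<otimes> inv a = (a \<otimes> q \<otimes> inv a) \<otimes> p"
    using assms by (simp add: m_assoc)
  have inj: "u = v" if "a \<otimes> u \<otimes> inv a = a \<otimes> v \<otimes> inv a" "u \<in> carrier G" "v \<in> carrier G" for u v
    using that assms by simp
  show ?thesis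
  proof
    assume "(inv a \<otimes> p \<otimes> a) \<otimes> q = q \<otimes> (inv a \<otimes> p \<otimes> a)"
    then show "(a \<otimes> q \<otimes> inv a) \<otimes> p = p \<otimes> (a \<otimes> q \<otimes> inv a)" using 1 2 by simp
  next
    assume e: "(a \<otimes> q \<otimes> inv a) \<otimes> p = p \<otimes> (a \<otimes> q \<otimes> inv a)"
    show "(inv a \<otimes> p \<otimes> a) \<otimes> q = q \<otimes> (inv a \<otimes> p \<otimes> a)"
      by (rule inj[OF trans[OF 1 trans[OF e[symmetric] 2[symmetric]]]]) (use assms in auto)
  qed
qed

text \<open>
  The computation behind the climb from one level to the next, in a single coordinate: \<open>x\<close> and
  \<open>x'\<close> come from the first level, where conjugation by \<open>a\<close> has no effect, while \<open>p\<close> and \<open>q\<close>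
  collect the higher levels, which \<open>a\<close> moves into commuting position.
\<close>
lemma (in group) commutator_of_commuting_parts:
  assumes c: "x \<in> carrier G" "x' \<in> carrier G" "p \<in> carrier G" "q \<in> carrier G" "a \<in> carrier G"
    and ax: "a \<otimes> x = x \<otimes> a" and ax': "a \<otimes> x' = x' \<otimes> a"
    and xp: "x' \<otimes> p = p \<otimes> x'" and xq: "x \<otimes> q = q \<otimes> x"
    and pq: "(inv a \<otimes> p \<otimes> a) \<otimes> q = q \<otimes> (inv a \<otimes> p \<otimes> a)"
  defines "y \<equiv> inv a \<otimes> (x \<otimes> p) \<otimes> a"
  shows "y \<otimes> (x' \<otimes> q) \<otimes> inv y \<otimes> inv (x' \<otimes> q) = x \<otimes> x' \<otimes> inv x \<otimes> inv x'"
proof -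
  define p' where "p' = inv a \<otimes> p \<otimes> a"
  have p': "p' \<in> carrier G" using c by (simp add: p'_def)
  have iax: "inv a \<otimes> x = x \<otimes> inv a"
  proof -
    have "inv a \<otimes> x = inv a \<otimes> (x \<otimes> a) \<otimes> inv a" using c by (simp add: m_assoc)
    also have "\<dots> = inv a \<otimes> (a \<otimes> x) \<otimes> inv a" using ax by simp
    also have "\<dots> = x \<otimes> inv a" using c by (simp flip: m_assoc)
    finally show ?thesis .
  qed
  have "y = (inv a \<otimes> x) \<otimes> (p \<otimes> a)" using c by (simp add: y_def m_assoc)
  also have "\<dots> = x \<otimes> p'" using c by (simp add: iax p'_def m_assoc)
  finally have y: "y = x \<otimes> p'" .
  have "(a \<otimes> x' \<otimes> inv a) = x'" using c ax' by (simp add: m_assoc)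
  then have px: "p' \<otimes> x' = x' \<otimes> p'"
    using commute_conj_iff[OF c(5,3,2)] xp by (simp add: p'_def)
  have pq': "p' \<otimes> q = q \<otimes> p'" using pq by (simp add: p'_def)
  let ?z = "x' \<otimes> q" and ?c = "x \<otimes> x' \<otimes> inv x \<otimes> inv x'"
  have "y \<otimes> ?z = x \<otimes> (p' \<otimes> x') \<otimes> q" using c p' by (simp add: y m_assoc)
  also have "\<dots> = x \<otimes> x' \<otimes> (p' \<otimes> q)" unfolding px using c p' by (simp add: m_assoc)
  also have "\<dots> = x \<otimes> x' \<otimes> q \<otimes> p'" unfolding pq' using c p' by (simp add: m_assoc)
  finally have l: "y \<otimes> ?z = x \<otimes> x' \<otimes> q \<otimes> p'" .
  have can: "inv u \<otimes> (u \<otimes> v) = v" if "u \<in> carrier G" "v \<in> carrier G" for u v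
    using that by (simp flip: m_assoc)
  have "?z \<otimes> y = x' \<otimes> (q \<otimes> x) \<otimes> p'" using c p' by (simp add: y m_assoc)
  also have "\<dots> = x' \<otimes> x \<otimes> q \<otimes> p'" unfolding xq[symmetric] using c p' by (simp add: m_assoc)
  finally have "?c \<otimes> (?z \<otimes> y) = x \<otimes> x' \<otimes> q \<otimes> p'" using c p' by (simp add: m_assoc can)
  with l have "y \<otimes> ?z = ?c \<otimes> (?z \<otimes> y)" by simp
  moreover have yc: "y \<in> carrier G" using c p' y by simp
  ultimately have "y \<otimes> ?z \<otimes> inv (?z \<otimes> y) = ?c" using c by (simp add: m_assoc)
  then show ?thesis using c yc by (simp add: inv_mult_group m_assoc)
qed

section \<open>Simple groups, simple quotients and complements\<close>

lemma (in group) simple_grp_central_trivial: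
  assumes S: "simple_grp G" and nc: "\<not> comm_group G"
    and z: "z \<in> carrier G" and central: "\<And>w. w \<in> carrier G \<Longrightarrow> z \<otimes> w = w \<otimes> z"
  shows "z = \<one>"
proof (rule ccontr)
  assume "z \<noteq> \<one>"
  define Z where "Z = {x \<in> carrier G. \<forall>w\<in>carrier G. x \<otimes> w = w \<otimes> x}"
  have ZI: "\<And>x w. x \<in> Z \<Longrightarrow> w \<in> carrier G \<Longrightarrow> w \<otimes> x \<otimes> inv w = x"
  proof -
    fix x w assume "x \<in> Z" and w: "w \<in> carrier G"
    then have x: "x \<in> carrier G" "w \<otimes> x = x \<otimes> w" by (auto simp: Z_def)
    then show "w \<otimes> x \<otimes> inv w = x" using w by (simp add: m_assoc)
  qed
  have "subgroup Z G"
  proof (rule subgroupI)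
    show "Z \<subseteq> carrier G" "Z \<noteq> {}" using Z_def by auto
    show "inv a \<in> Z" if "a \<in> Z" for a
    proof -
      have a: "a \<in> carrier G" "\<And>w. w \<in> carrier G \<Longrightarrow> a \<otimes> w = w \<otimes> a" using that by (auto simp: Z_def)
      have "inv a \<otimes> w = w \<otimes> inv a" if w: "w \<in> carrier G" for w
      proof -
        have "inv a \<otimes> w = inv (inv w \<otimes> a)" using a(1) w by (simp add: inv_mult_group)
        also have "\<dots> = inv (a \<otimes> inv w)" using a(2)[of "inv w"] w by simp
        also have "\<dots> = w \<otimes> inv a" using a(1) w by (simp add: inv_mult_group)
        finally show ?thesis .
      qed
      then show ?thesis using a by (simp add: Z_def)
    qed
    show "a \<otimes> b \<in> Z" if "a \<in> Z" "b \<in> Z" for a b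
    proof -
      have c: "a \<in> carrier G" "b \<in> carrier G"
        and comm: "\<And>w. w \<in> carrier G \<Longrightarrow> a \<otimes> w = w \<otimes> a" "\<And>w. w \<in> carrier G \<Longrightarrow> b \<otimes> w = w \<otimes> b"
        using that by (auto simp: Z_def)
      have "(a \<otimes> b) \<otimes> w = w \<otimes> (a \<otimes> b)" if w: "w \<in> carrier G" for w
      proof -
        have "(a \<otimes> b) \<otimes> w = a \<otimes> (w \<otimes> b)" using c w comm(2)[OF w] by (simp add: m_assoc)
        also have "\<dots> = (w \<otimes> a) \<otimes> b" using c w comm(1)[OF w] by (simp flip: m_assoc)
        finally show ?thesis using c w by (simp add: m_assoc)
      qed
      then show ?thesis using c by (simp add: Z_def)
    qed
  qed
  moreover have "\<forall>x\<in>carrier G. \<forall>h\<in>Z. x \<otimes> h \<otimes> inv x \<in> Z" using ZI by simp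
  ultimately have "Z \<lhd> G" using normal_inv_iff by blast
  moreover have "z \<in> Z" using z central Z_def by auto
  ultimately have "Z = carrier G" using S \<open>z \<noteq> \<one>\<close> unfolding simple_grp_def by blast
  then have "comm_group G" using group_comm_groupI Z_def by blast
  with nc show False by blast
qed

text \<open>
  \<open>N\<close> is isomorphic to the quotient of \<open>G\<close> by \<open>M\<close>, so representatives in \<open>N\<close> of the cosets of
  the generators should generate \<open>N\<close>. The subgroup \<open>T\<close> that they generate satisfies \<open>M T = G\<close>, and
  the modular law gives \<open>N = T\<close>.
\<close>
lemma (in group) finitely_generated_if_normal_complement:
  assumes M: "M \<lhd> G" and N: "subgroup N G" and NM: "N \<inter> M = {\<one>}" "N <#> M = carrier G"
    and fg: "finitely_generated_in G (carrier G)"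
  shows "finitely_generated_in G N"
proof -
  obtain S where S: "finite S" "S \<subseteq> carrier G" "generate G S = carrier G"
    using fg unfolding finitely_generated_in_def by auto
  have "\<exists>n\<in>N. \<exists>m\<in>M. s = m \<otimes> n" if "s \<in> S" for s
    using that S(2) NM(2) commut_normal[OF N M] unfolding set_mult_def by blast
  then obtain f where f: "\<And>s. s \<in> S \<Longrightarrow> f s \<in> N \<and> (\<exists>m\<in>M. s = m \<otimes> f s)" by metis
  define T where "T = generate G (f ` S)"
  have TN: "T \<subseteq> N" unfolding T_def by (rule generate_subgroup_incl) (use f N in auto)
  have sT: "subgroup T G"
    unfolding T_def by (rule generate_is_subgroup) (use f N subgroup.subset in blast)
  have "subgroup (M <#> T) G" using mult_norm_subgroup[OF M sT] .
  moreover have "S \<subseteq> M <#> T"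
  proof
    fix s assume "s \<in> S"
    moreover have "f s \<in> T" unfolding T_def using \<open>s \<in> S\<close> by (simp add: generate.incl)
    ultimately show "s \<in> M <#> T" using f unfolding set_mult_def by blast
  qed
  ultimately have MT: "carrier G \<subseteq> M <#> T" using S(3) generate_subgroup_incl by metis
  have "N \<subseteq> T"
  proof
    fix x assume x: "x \<in> N"
    then obtain m t where mt: "m \<in> M" "t \<in> T" "x = m \<otimes> t"
      using MT N subgroup.subset unfolding set_mult_def by blast
    have c: "m \<in> carrier G" "t \<in> carrier G" "x \<in> carrier G"
      using mt x N M sT by (meson normal_imp_subgroup subgroup.mem_carrier)+
    have "m = x \<otimes> inv t" using mt c by (simp add: m_assoc)
    moreover have "x \<otimes> inv t \<in> N"
      using x mt(2) TN N by (meson subgroup.m_closed subgroup.m_inv_closed subsetD)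
    ultimately have "m = \<one>" using mt NM by blast
    then show "x \<in> T" using mt c by simp
  qed
  with TN have "generate G (f ` S) = N" unfolding T_def by blast
  then show ?thesis unfolding finitely_generated_in_def
    using S(1) f by blast
qed

lemma (in normal) simple_quotient_dichotomy:
  assumes Q: "simple_grp (G Mod H)" and N: "N \<lhd> G"
  shows "N \<subseteq> H \<or> carrier G \<subseteq> N <#> H"
proof -
  have hom: "group_hom G (G Mod H) (\<lambda>x. H #> x)"
    by (simp add: group_hom_def group_hom_axioms_def factorgroup_is_group r_coset_hom_Mod)
  have "(\<lambda>x. H #> x) ` N \<lhd> G Mod H"
    by (rule normal.surj_hom_normal_subgroup[OF N hom]) (simp add: carrier_FactGroup)
  then consider "(\<lambda>x. H #> x) ` N = (\<lambda>x. H #> x) ` carrier G" | "(\<lambda>x. H #> x) ` N = {H}"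
    using Q unfolding simple_grp_def by (auto simp: carrier_FactGroup)
  then show ?thesis
  proof cases
    case 1
    have "x \<in> N <#> H" if x: "x \<in> carrier G" for x
    proof -
      obtain n where n: "n \<in> N" "H #> x = H #> n" using 1 x by (metis (no_types, lifting) imageE imageI)
      then have "x \<in> H #> n" using rcos_self[OF x subgroup_axioms] by simp
      then have "x \<in> H <#> N" using n unfolding r_coset_def set_mult_def by blast
      then show ?thesis using commut_normal[OF normal_imp_subgroup[OF N] normal_axioms] by simp
    qed
    then show ?thesis by blast
  next
    case 2
    have "n \<in> H" if "n \<in> N" for n
      using 2 that coset_join1[OF _ _ subgroup_axioms] N
      by (metis (no_types, lifting) imageI normal_imp_subgroup singletonD subgroup.mem_carrier)
    then show ?thesis by blast
  qed
qed

section \<open>Normal subgroups between the direct sum and the direct product\<close>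

definition single :: "'i set \<Rightarrow> ('i \<Rightarrow> ('a, 'm) monoid_scheme) \<Rightarrow> 'i \<Rightarrow> 'a \<Rightarrow> 'i \<Rightarrow> 'a" where
  "single I \<Omega> i w = (\<lambda>j\<in>I. if j = i then w else \<one>\<^bsub>\<Omega> j\<^esub>)"

definition support :: "'i set \<Rightarrow> ('i \<Rightarrow> ('a, 'm) monoid_scheme) \<Rightarrow> ('i \<Rightarrow> 'a) set \<Rightarrow> 'i set" where
  "support I \<Omega> N = {i \<in> I. \<exists>x\<in>N. x i \<noteq> \<one>\<^bsub>\<Omega> i\<^esub>}"

lemma finite_part_in_subgroup:
  assumes gr: "\<And>i. i \<in> I \<Longrightarrow> group (\<Omega> i)" and N: "subgroup N (product_group I \<Omega>)"
    and F: "finite F" "F \<subseteq> I" "\<And>i w. i \<in> F \<Longrightarrow> w \<in> carrier (\<Omega> i) \<Longrightarrow> single I \<Omega> i w \<in> N"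
    and x: "x \<in> (\<Pi>\<^sub>E i\<in>I. carrier (\<Omega> i))" "\<And>i. i \<in> I - F \<Longrightarrow> x i = \<one>\<^bsub>\<Omega> i\<^esub>"
  shows "x \<in> N"
  using F x
proof (induction F arbitrary: x rule: finite_induct)
  case empty
  have "x = (\<lambda>i\<in>I. \<one>\<^bsub>\<Omega> i\<^esub>)"
    using empty.prems(3,4) by (intro PiE_ext[of x I "\<lambda>i. carrier (\<Omega> i)"])
      (auto simp: group.is_monoid[OF gr])
  moreover have "(\<lambda>i\<in>I. \<one>\<^bsub>\<Omega> i\<^esub>) \<in> N"
    using subgroup.one_closed[OF N] unfolding one_product_group .
  ultimately show ?case by (simp only:)
next
  case (insert i F)
  have iI: "i \<in> I" using insert.prems by auto
  have xc: "x j \<in> carrier (\<Omega> j)" if "j \<in> I" for j using insert.prems(3) that by (meson PiE_mem)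
  let ?s = "single I \<Omega> i (x i)"
  define y where "y = (\<lambda>j\<in>I. if j = i then \<one>\<^bsub>\<Omega> i\<^esub> else x j)"
  have y: "y \<in> N"
  proof (rule insert.IH)
    show "F \<subseteq> I" using insert.prems by auto
    show "y \<in> (\<Pi>\<^sub>E i\<in>I. carrier (\<Omega> i))"
      using xc by (auto simp: y_def group.is_monoid[OF gr])
    show "y j = \<one>\<^bsub>\<Omega> j\<^esub>" if "j \<in> I - F" for j
      using that insert.prems(4)[of j] by (auto simp: y_def)
  qed (use insert.prems(2) in auto)
  have s: "?s \<in> N" using insert.prems(2) xc[OF iI] by auto
  have "?s \<otimes>\<^bsub>product_group I \<Omega>\<^esub> y \<in> N" by (rule subgroup.m_closed[OF N s y])
  also have "?s \<otimes>\<^bsub>product_group I \<Omega>\<^esub> y = x"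
  proof
    fix j show "(?s \<otimes>\<^bsub>product_group I \<Omega>\<^esub> y) j = x j"
      using xc[of j] xc[OF iI] PiE_arb[OF insert.prems(3), of j] group.is_monoid[OF gr, of j]
        group.is_monoid[OF gr[OF iI]]
      by (auto simp: single_def y_def)
  qed
  finally show ?case .
qed

locale simple_subproduct =
  fixes I :: "'i set" and \<Omega> :: "'i \<Rightarrow> ('a, 'm) monoid_scheme" and K :: "('i \<Rightarrow> 'a) set"
  assumes simple: "i \<in> I \<Longrightarrow> simple_grp (\<Omega> i)"
    and nonabelian: "i \<in> I \<Longrightarrow> \<not> comm_group (\<Omega> i)"
    and K: "subgroup K (product_group I \<Omega>)"
    and sum_le_K: "carrier (sum_group I \<Omega>) \<subseteq> K"
begin

abbreviation P where "P \<equiv> product_group I \<Omega>"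
abbreviation H where "H \<equiv> P\<lparr>carrier := K\<rparr>"
abbreviation D where "D \<equiv> carrier (sum_group I \<Omega>)"

lemma group_factor: "i \<in> I \<Longrightarrow> group (\<Omega> i)"
  using simple simple_grp_def by blast

sublocale P: group P
  by (rule product_group) (rule group_factor)

sublocale H: group H
  by (rule subgroup.subgroup_is_group[OF K]) (rule P.is_group)

lemma K_carrier: "x \<in> K \<Longrightarrow> x \<in> (\<Pi>\<^sub>E i\<in>I. carrier (\<Omega> i))"
  using K subgroup.mem_carrier by fastforce

lemma K_coord: "x \<in> K \<Longrightarrow> i \<in> I \<Longrightarrow> x i \<in> carrier (\<Omega> i)"
  using K_carrier by (meson PiE_mem)

lemma inv_K: "x \<in> K \<Longrightarrow> inv\<^bsub>H\<^esub> x = (\<lambda>i\<in>I. inv\<^bsub>\<Omega> i\<^esub> x i)"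
  using P.m_inv_consistent[OF K] K_carrier group_factor by (simp add: inv_product_group)

lemma K_eqI: "x \<in> K \<Longrightarrow> y \<in> K \<Longrightarrow> (\<And>i. i \<in> I \<Longrightarrow> x i = y i) \<Longrightarrow> x = y"
  using K_carrier by (meson PiE_ext)

lemma D_iff: "x \<in> D \<longleftrightarrow> x \<in> K \<and> finite {i \<in> I. x i \<noteq> \<one>\<^bsub>\<Omega> i\<^esub>}"
  using sum_le_K K_carrier carrier_sum_group[of I \<Omega>, OF group_factor] by blast

lemma K_mult: "x \<in> K \<Longrightarrow> y \<in> K \<Longrightarrow> (\<lambda>i\<in>I. x i \<otimes>\<^bsub>\<Omega> i\<^esub> y i) \<in> K"
  using H.m_closed[of x y] by simp

lemma K_inv: "x \<in> K \<Longrightarrow> (\<lambda>i\<in>I. inv\<^bsub>\<Omega> i\<^esub> x i) \<in> K"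
  using H.inv_closed[of x] inv_K by simp

lemma single_in_D: "i \<in> I \<Longrightarrow> w \<in> carrier (\<Omega> i) \<Longrightarrow> single I \<Omega> i w \<in> D"
proof -
  assume i: "i \<in> I" and w: "w \<in> carrier (\<Omega> i)"
  have "{j \<in> I. single I \<Omega> i w j \<noteq> \<one>\<^bsub>\<Omega> j\<^esub>} \<subseteq> {i}" by (auto simp: single_def)
  then have "finite {j \<in> I. single I \<Omega> i w j \<noteq> \<one>\<^bsub>\<Omega> j\<^esub>}" using finite_subset by blast
  moreover have "single I \<Omega> i w \<in> (\<Pi>\<^sub>E i\<in>I. carrier (\<Omega> i))"
    using i w group_factor by (auto simp: single_def group.is_monoid)
  ultimately show ?thesis using carrier_sum_group[of I \<Omega>, OF group_factor] by blast
qed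

lemma single_in_K: "i \<in> I \<Longrightarrow> w \<in> carrier (\<Omega> i) \<Longrightarrow> single I \<Omega> i w \<in> K"
  using single_in_D sum_le_K by blast

lemma normal_coordinate_closed:
  assumes N: "N \<lhd> H" and x: "x \<in> N" "x \<in> K" and y: "y \<in> K"
  shows "(\<lambda>i\<in>I. y i \<otimes>\<^bsub>\<Omega> i\<^esub> x i \<otimes>\<^bsub>\<Omega> i\<^esub> inv\<^bsub>\<Omega> i\<^esub> y i) \<in> N"
proof -
  have "y \<otimes>\<^bsub>H\<^esub> x \<otimes>\<^bsub>H\<^esub> inv\<^bsub>H\<^esub> y \<in> N"
    by (rule H.normal_invE(2)[OF N]) (use x y in auto)
  moreover have "y \<otimes>\<^bsub>H\<^esub> x \<otimes>\<^bsub>H\<^esub> inv\<^bsub>H\<^esub> y = (\<lambda>i\<in>I. y i \<otimes>\<^bsub>\<Omega> i\<^esub> x i \<otimes>\<^bsub>\<Omega> i\<^esub> inv\<^bsub>\<Omega> i\<^esub> y i)"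
    using y by (simp add: inv_K cong: restrict_cong)
  ultimately show ?thesis by simp
qed

lemma subgroup_coordinate_closed:
  assumes "subgroup N H"
  shows "\<And>x. x \<in> N \<Longrightarrow> x \<in> K"
    and "\<And>x y. x \<in> N \<Longrightarrow> y \<in> N \<Longrightarrow> (\<lambda>i\<in>I. x i \<otimes>\<^bsub>\<Omega> i\<^esub> y i) \<in> N"
    and "\<And>x. x \<in> N \<Longrightarrow> (\<lambda>i\<in>I. inv\<^bsub>\<Omega> i\<^esub> x i) \<in> N"
    and "(\<lambda>i\<in>I. \<one>\<^bsub>\<Omega> i\<^esub>) \<in> N"
proof -
  show sub: "\<And>x. x \<in> N \<Longrightarrow> x \<in> K" using subgroup.mem_carrier[OF assms] by simp
  show "\<And>x y. x \<in> N \<Longrightarrow> y \<in> N \<Longrightarrow> (\<lambda>i\<in>I. x i \<otimes>\<^bsub>\<Omega> i\<^esub> y i) \<in> N"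
    using subgroup.m_closed[OF assms] by simp
  show "\<And>x. x \<in> N \<Longrightarrow> (\<lambda>i\<in>I. inv\<^bsub>\<Omega> i\<^esub> x i) \<in> N"
    using subgroup.m_inv_closed[OF assms] sub inv_K by fastforce
  show "(\<lambda>i\<in>I. \<one>\<^bsub>\<Omega> i\<^esub>) \<in> N"
    using subgroup.one_closed[OF assms] by simp
qed

lemma normalI_coordinates:
  assumes sub: "N \<subseteq> K" and one: "(\<lambda>i\<in>I. \<one>\<^bsub>\<Omega> i\<^esub>) \<in> N"
    and mult: "\<And>x y. x \<in> N \<Longrightarrow> y \<in> N \<Longrightarrow> (\<lambda>i\<in>I. x i \<otimes>\<^bsub>\<Omega> i\<^esub> y i) \<in> N"
    and inv: "\<And>x. x \<in> N \<Longrightarrow> (\<lambda>i\<in>I. inv\<^bsub>\<Omega> i\<^esub> x i) \<in> N"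
    and conj: "\<And>x y. x \<in> N \<Longrightarrow> y \<in> K \<Longrightarrow>
                 (\<lambda>i\<in>I. y i \<otimes>\<^bsub>\<Omega> i\<^esub> x i \<otimes>\<^bsub>\<Omega> i\<^esub> inv\<^bsub>\<Omega> i\<^esub> y i) \<in> N"
  shows "N \<lhd> H"
  unfolding H.normal_inv_iff
proof (intro conjI ballI)
  show "subgroup N H"
  proof (rule H.subgroupI)
    show "N \<subseteq> carrier H" "N \<noteq> {}" using sub one by auto
    show "inv\<^bsub>H\<^esub> a \<in> N" if "a \<in> N" for a using inv[OF that] inv_K sub that by auto
    show "a \<otimes>\<^bsub>H\<^esub> b \<in> N" if "a \<in> N" "b \<in> N" for a b using mult that by simp
  qed
  show "y \<otimes>\<^bsub>H\<^esub> x \<otimes>\<^bsub>H\<^esub> inv\<^bsub>H\<^esub> y \<in> N" if "y \<in> carrier H" "x \<in> N" for x y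
  proof -
    have "y \<otimes>\<^bsub>H\<^esub> x \<otimes>\<^bsub>H\<^esub> inv\<^bsub>H\<^esub> y = (\<lambda>i\<in>I. y i \<otimes>\<^bsub>\<Omega> i\<^esub> x i \<otimes>\<^bsub>\<Omega> i\<^esub> inv\<^bsub>\<Omega> i\<^esub> y i)"
      using that by (simp add: inv_K cong: restrict_cong)
    then show ?thesis using conj that by simp
  qed
qed

lemma D_normal: "D \<lhd> H"
proof (rule normalI_coordinates)
  note [simp] = group.is_monoid[OF group_factor] monoid.inv_one[OF group.is_monoid[OF group_factor]]
  have one: "(\<lambda>i\<in>I. \<one>\<^bsub>\<Omega> i\<^esub>) \<in> K" using H.one_closed by simp
  show "D \<subseteq> K" by (rule sum_le_K)
  show "(\<lambda>i\<in>I. \<one>\<^bsub>\<Omega> i\<^esub>) \<in> D" using one by (simp add: D_iff)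
  have fin: "z \<in> D"
    if a: "x \<in> D" "z \<in> K" "\<And>i. i \<in> I \<Longrightarrow> x i = \<one>\<^bsub>\<Omega> i\<^esub> \<Longrightarrow> y i = \<one>\<^bsub>\<Omega> i\<^esub> \<Longrightarrow> z i = \<one>\<^bsub>\<Omega> i\<^esub>" "y \<in> D"
    for x y z
  proof -
    have "{i\<in>I. z i \<noteq> \<one>\<^bsub>\<Omega> i\<^esub>} \<subseteq> {i\<in>I. x i \<noteq> \<one>\<^bsub>\<Omega> i\<^esub>} \<union> {i\<in>I. y i \<noteq> \<one>\<^bsub>\<Omega> i\<^esub>}"
      using a(3) by blast
    then have "finite {i\<in>I. z i \<noteq> \<one>\<^bsub>\<Omega> i\<^esub>}"
      using a(1,4) D_iff by (meson finite_UnI finite_subset)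
    then show "z \<in> D" using a(2) D_iff by blast
  qed
  show "(\<lambda>i\<in>I. x i \<otimes>\<^bsub>\<Omega> i\<^esub> y i) \<in> D" if "x \<in> D" "y \<in> D" for x y
    by (rule fin[OF that(1) K_mult _ that(2)]) (use that sum_le_K in auto)
  show "(\<lambda>i\<in>I. inv\<^bsub>\<Omega> i\<^esub> x i) \<in> D" if "x \<in> D" for x
    by (rule fin[OF that K_inv _ that]) (use that sum_le_K in auto)
  show "(\<lambda>i\<in>I. y i \<otimes>\<^bsub>\<Omega> i\<^esub> x i \<otimes>\<^bsub>\<Omega> i\<^esub> inv\<^bsub>\<Omega> i\<^esub> y i) \<in> D" if "x \<in> D" "y \<in> K" for x y
  proof (rule fin[OF that(1) _ _ that(1)])
    have xK: "x \<in> K" using that sum_le_K by blast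
    show "(\<lambda>i\<in>I. y i \<otimes>\<^bsub>\<Omega> i\<^esub> x i \<otimes>\<^bsub>\<Omega> i\<^esub> inv\<^bsub>\<Omega> i\<^esub> y i) \<in> K"
      using K_mult[OF K_mult[OF that(2) xK] K_inv[OF that(2)]] by (simp cong: restrict_cong)
    show "(\<lambda>i\<in>I. y i \<otimes>\<^bsub>\<Omega> i\<^esub> x i \<otimes>\<^bsub>\<Omega> i\<^esub> inv\<^bsub>\<Omega> i\<^esub> y i) i = \<one>\<^bsub>\<Omega> i\<^esub>"
      if "i \<in> I" "x i = \<one>\<^bsub>\<Omega> i\<^esub>" for i
      using that K_coord[OF \<open>y \<in> K\<close>] group_factor[OF that(1)] by (simp add: group.r_inv)
  qed
qed

text \<open>
  The \<open>w\<close> whose copy at \<open>i\<close> lies in \<open>N\<close> form a normal subgroup \<open>T\<close> of the simple group \<open>\<Omega> i\<close>. Were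
  \<open>T\<close> trivial, the commutators of \<open>x \<in> N\<close> with copies at \<open>i\<close>, which lie in \<open>N\<close> and live at \<open>i\<close>
  only, would make \<open>x i\<close> central for every \<open>x \<in> N\<close>.
\<close>
lemma single_in_normal_if_support:
  assumes N: "N \<lhd> H" and i: "i \<in> support I \<Omega> N" and w: "w \<in> carrier (\<Omega> i)"
  shows "single I \<Omega> i w \<in> N"
proof -
  obtain x where x: "x \<in> N" "x i \<noteq> \<one>\<^bsub>\<Omega> i\<^esub>" and iI: "i \<in> I"
    using i by (auto simp: support_def)
  interpret Oi: group "\<Omega> i" by (rule group_factor[OF iI])
  note NS = subgroup_coordinate_closed[OF normal_imp_subgroup[OF N]]
  note [simp] = group.is_monoid[OF group_factor] group.is_group[OF group_factor]
    monoid.inv_one[OF group.is_monoid[OF group_factor]]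
  define T where "T = {w \<in> carrier (\<Omega> i). single I \<Omega> i w \<in> N}"
  have s1: "single I \<Omega> i \<one>\<^bsub>\<Omega> i\<^esub> = (\<lambda>i\<in>I. \<one>\<^bsub>\<Omega> i\<^esub>)"
    by (auto simp: single_def)
  have s2: "single I \<Omega> i (a \<otimes>\<^bsub>\<Omega> i\<^esub> b) = (\<lambda>j\<in>I. single I \<Omega> i a j \<otimes>\<^bsub>\<Omega> j\<^esub> single I \<Omega> i b j)" for a b
    by (rule ext) (auto simp: single_def)
  have s3: "single I \<Omega> i (inv\<^bsub>\<Omega> i\<^esub> a) = (\<lambda>j\<in>I. inv\<^bsub>\<Omega> j\<^esub> single I \<Omega> i a j)" for a
    by (rule ext) (auto simp: single_def)
  have s4: "single I \<Omega> i (b \<otimes>\<^bsub>\<Omega> i\<^esub> a \<otimes>\<^bsub>\<Omega> i\<^esub> inv\<^bsub>\<Omega> i\<^esub> b)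
     = (\<lambda>j\<in>I. single I \<Omega> i b j \<otimes>\<^bsub>\<Omega> j\<^esub> single I \<Omega> i a j \<otimes>\<^bsub>\<Omega> j\<^esub> inv\<^bsub>\<Omega> j\<^esub> single I \<Omega> i b j)" for a b
    by (rule ext) (auto simp: single_def)
  have T1: "\<one>\<^bsub>\<Omega> i\<^esub> \<in> T" using NS(4) s1 by (simp add: T_def)
  have "T \<lhd> \<Omega> i"
    unfolding Oi.normal_inv_iff
  proof (intro conjI ballI)
    show "subgroup T (\<Omega> i)"
    proof (rule Oi.subgroupI)
      show "T \<subseteq> carrier (\<Omega> i)" "T \<noteq> {}" using T1 by (auto simp: T_def)
      show "inv\<^bsub>\<Omega> i\<^esub> a \<in> T" if "a \<in> T" for a using that NS(3) s3 by (auto simp: T_def)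
      show "a \<otimes>\<^bsub>\<Omega> i\<^esub> b \<in> T" if "a \<in> T" "b \<in> T" for a b
        using that NS(2) s2 by (auto simp: T_def)
    qed
    show "b \<otimes>\<^bsub>\<Omega> i\<^esub> a \<otimes>\<^bsub>\<Omega> i\<^esub> inv\<^bsub>\<Omega> i\<^esub> b \<in> T" if "b \<in> carrier (\<Omega> i)" "a \<in> T" for a b
      using that normal_coordinate_closed[OF N _ NS(1) single_in_K[OF iI]] s4 by (auto simp: T_def)
  qed
  then consider "T = carrier (\<Omega> i)" | "T = {\<one>\<^bsub>\<Omega> i\<^esub>}"
    using simple[OF iI] by (auto simp: simple_grp_def)
  then show ?thesis
  proof cases
    case 1
    then show ?thesis using w by (auto simp: T_def)
  next
    case 2
    have xK: "x \<in> K" using NS(1) x by blast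
    have "x i = \<one>\<^bsub>\<Omega> i\<^esub>"
    proof (rule Oi.simple_grp_central_trivial[OF simple[OF iI] nonabelian[OF iI] K_coord[OF xK iI]])
      fix v assume v: "v \<in> carrier (\<Omega> i)"
      let ?c = "v \<otimes>\<^bsub>\<Omega> i\<^esub> x i \<otimes>\<^bsub>\<Omega> i\<^esub> inv\<^bsub>\<Omega> i\<^esub> v \<otimes>\<^bsub>\<Omega> i\<^esub> inv\<^bsub>\<Omega> i\<^esub> x i"
      let ?s = "single I \<Omega> i v"
      have "single I \<Omega> i ?c = (\<lambda>j\<in>I. (\<lambda>j\<in>I. ?s j \<otimes>\<^bsub>\<Omega> j\<^esub> x j \<otimes>\<^bsub>\<Omega> j\<^esub> inv\<^bsub>\<Omega> j\<^esub> ?s j) j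
          \<otimes>\<^bsub>\<Omega> j\<^esub> (\<lambda>j\<in>I. inv\<^bsub>\<Omega> j\<^esub> x j) j)"
        by (rule ext) (auto simp: single_def K_coord[OF xK] group.r_inv group.inv_closed)
      also have "\<dots> \<in> N"
        by (intro NS(2) NS(3) normal_coordinate_closed[OF N] x xK single_in_K iI v)
      finally have "?c \<in> T" using v K_coord[OF xK iI] by (simp add: T_def)
      then have "?c = \<one>\<^bsub>\<Omega> i\<^esub>" using 2 by blast
      then show "x i \<otimes>\<^bsub>\<Omega> i\<^esub> v = v \<otimes>\<^bsub>\<Omega> i\<^esub> x i"
        using Oi.commutator_one_iff[OF v K_coord[OF xK iI]] by simp
    qed
    with x show ?thesis by blast
  qed
qed

lemma finite_part_in_normal:
  assumes N: "N \<lhd> H" and F: "finite F" "F \<subseteq> support I \<Omega> N"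
    and x: "x \<in> K" "\<And>i. i \<in> I - F \<Longrightarrow> x i = \<one>\<^bsub>\<Omega> i\<^esub>"
  shows "x \<in> N"
proof (rule finite_part_in_subgroup[OF group_factor _ F(1) _ _ K_carrier[OF x(1)] x(2)])
  show "subgroup N P" by (rule P.incl_subgroup[OF K normal_imp_subgroup[OF N]])
  show "F \<subseteq> I" using F(2) by (auto simp: support_def)
  show "single I \<Omega> i w \<in> N" if "i \<in> F" "w \<in> carrier (\<Omega> i)" for i w
    using single_in_normal_if_support[OF N _ that(2)] F(2) that(1) by blast
qed

text \<open>
  The complement \<open>M\<close> consists of the elements of \<open>L\<close> that vanish on the support of \<open>N\<close>. An element
  \<open>n d\<close> of \<open>N L\<close> is seen to lie in \<open>N M\<close> by moving the part \<open>e\<close> of \<open>d\<close> on the support to the left factor: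
  being finite, this part belongs to \<open>D\<close>, hence to \<open>L\<close>, and also to \<open>N\<close>.
\<close>
lemma direct_factorI:
  assumes N: "N \<lhd> H" and L: "L \<lhd> H" "D \<subseteq> L"
    and fin: "\<And>d. d \<in> L \<Longrightarrow> finite {i \<in> support I \<Omega> N. d i \<noteq> \<one>\<^bsub>\<Omega> i\<^esub>}"
    and NL: "K \<subseteq> N <#>\<^bsub>H\<^esub> L"
  shows "direct_factor H N"
proof -
  define M where "M = {x \<in> L. \<forall>i\<in>support I \<Omega> N. x i = \<one>\<^bsub>\<Omega> i\<^esub>}"
  note NS = subgroup_coordinate_closed[OF normal_imp_subgroup[OF N]]
  note LS = subgroup_coordinate_closed[OF normal_imp_subgroup[OF L(1)]]
  note [simp] = group.is_monoid[OF group_factor] group.is_group[OF group_factor]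
    monoid.inv_one[OF group.is_monoid[OF group_factor]] group.r_inv[OF group_factor] group.l_inv[OF group_factor]
  have suppI: "\<And>i. i \<in> support I \<Omega> N \<Longrightarrow> i \<in> I" by (simp add: support_def)
  have M: "M \<lhd> H"
  proof (rule normalI_coordinates)
    show "M \<subseteq> K" using LS(1) by (auto simp: M_def)
    show "(\<lambda>i\<in>I. \<one>\<^bsub>\<Omega> i\<^esub>) \<in> M" using LS(4) suppI by (auto simp: M_def)
    show "(\<lambda>i\<in>I. x i \<otimes>\<^bsub>\<Omega> i\<^esub> y i) \<in> M" if "x \<in> M" "y \<in> M" for x y
      using that LS(2) suppI by (auto simp: M_def)
    show "(\<lambda>i\<in>I. inv\<^bsub>\<Omega> i\<^esub> x i) \<in> M" if "x \<in> M" for x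
      using that LS(3) suppI by (auto simp: M_def)
    show "(\<lambda>i\<in>I. y i \<otimes>\<^bsub>\<Omega> i\<^esub> x i \<otimes>\<^bsub>\<Omega> i\<^esub> inv\<^bsub>\<Omega> i\<^esub> y i) \<in> M" if "x \<in> M" "y \<in> K" for x y
      using that normal_coordinate_closed[OF L(1) _ LS(1) that(2)] suppI K_coord[OF that(2)]
      by (auto simp: M_def)
  qed
  have "N \<inter> M \<subseteq> {\<one>\<^bsub>H\<^esub>}"
  proof
    fix x assume x: "x \<in> N \<inter> M"
    have "x = (\<lambda>i\<in>I. \<one>\<^bsub>\<Omega> i\<^esub>)"
    proof (rule K_eqI)
      show "x \<in> K" "(\<lambda>i\<in>I. \<one>\<^bsub>\<Omega> i\<^esub>) \<in> K" using x NS by auto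
      show "x i = (\<lambda>i\<in>I. \<one>\<^bsub>\<Omega> i\<^esub>) i" if "i \<in> I" for i
        using x that by (cases "i \<in> support I \<Omega> N") (auto simp: M_def support_def)
    qed
    then show "x \<in> {\<one>\<^bsub>H\<^esub>}" by simp
  qed
  moreover have "\<one>\<^bsub>H\<^esub> \<in> N \<inter> M"
    using N M by (metis Int_iff normal_imp_subgroup subgroup.one_closed)
  ultimately have triv: "N \<inter> M = {\<one>\<^bsub>H\<^esub>}" by blast
  have "K \<subseteq> N <#>\<^bsub>H\<^esub> M"
  proof
    fix x assume "x \<in> K"
    then obtain n d where nd: "n \<in> N" "d \<in> L" "x = n \<otimes>\<^bsub>H\<^esub> d"
      using NL unfolding set_mult_def by blast
    let ?F = "{i \<in> support I \<Omega> N. d i \<noteq> \<one>\<^bsub>\<Omega> i\<^esub>}"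
    define e where "e = (\<lambda>i\<in>I. if i \<in> ?F then d i else \<one>\<^bsub>\<Omega> i\<^esub>)"
    have dK: "d \<in> K" using nd LS by blast
    have "e \<in> (\<Pi>\<^sub>E i\<in>I. carrier (\<Omega> i))" using K_coord[OF dK] by (auto simp: e_def)
    moreover have "{i\<in>I. e i \<noteq> \<one>\<^bsub>\<Omega> i\<^esub>} \<subseteq> ?F" by (auto simp: e_def)
    ultimately have eD: "e \<in> D"
      using carrier_sum_group[of I \<Omega>, OF group_factor] fin[OF nd(2)] finite_subset by blast
    then have eK: "e \<in> K" using sum_le_K by blast
    have eN: "e \<in> N"
      by (rule finite_part_in_normal[OF N fin[OF nd(2)] _ eK]) (auto simp: e_def)
    have eL: "e \<in> L" using eD L by blast
    let ?m = "inv\<^bsub>H\<^esub> e \<otimes>\<^bsub>H\<^esub> d"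
    have mL: "?m \<in> L"
      using eL nd(2) normal_imp_subgroup[OF L(1)] by (meson subgroup.m_closed subgroup.m_inv_closed)
    have "?m i = \<one>\<^bsub>\<Omega> i\<^esub>" if "i \<in> support I \<Omega> N" for i
    proof -
      have i: "i \<in> I" by (rule suppI[OF that])
      have "e i = d i" using that i by (simp add: e_def)
      then have "?m i = inv\<^bsub>\<Omega> i\<^esub> d i \<otimes>\<^bsub>\<Omega> i\<^esub> d i" using inv_K[OF eK] i by simp
      then show ?thesis using i K_coord[OF dK i] by simp
    qed
    then have mM: "?m \<in> M" using mL unfolding M_def by blast
    have "x = (n \<otimes>\<^bsub>H\<^esub> e) \<otimes>\<^bsub>H\<^esub> ?m"
    proof -
      have c: "n \<in> carrier H" "e \<in> carrier H" "d \<in> carrier H" using nd eK dK NS(1) by auto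
      have "(n \<otimes>\<^bsub>H\<^esub> e) \<otimes>\<^bsub>H\<^esub> ?m = n \<otimes>\<^bsub>H\<^esub> (e \<otimes>\<^bsub>H\<^esub> (inv\<^bsub>H\<^esub> e \<otimes>\<^bsub>H\<^esub> d))"
        using c by (intro H.m_assoc H.m_closed H.inv_closed)
      also have "e \<otimes>\<^bsub>H\<^esub> (inv\<^bsub>H\<^esub> e \<otimes>\<^bsub>H\<^esub> d) = d"
        using c H.m_assoc[OF c(2) H.inv_closed[OF c(2)] c(3)] H.r_inv[OF c(2)] H.l_one[OF c(3)] by metis
      finally show ?thesis using nd(3) by metis
    qed
    moreover have "n \<otimes>\<^bsub>H\<^esub> e \<in> N"
      using nd(1) eN normal_imp_subgroup[OF N] by (meson subgroup.m_closed)
    ultimately show "x \<in> N <#>\<^bsub>H\<^esub> M" using mM unfolding set_mult_def by blast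
  qed
  moreover have "N <#>\<^bsub>H\<^esub> M \<subseteq> carrier H"
    by (rule H.setmult_subset_G) (use NS(1) LS(1) in \<open>auto simp: M_def\<close>)
  ultimately show ?thesis using N M triv unfolding direct_factor_def by auto
qed

lemma finite_support_if_finitely_generated:
  assumes fg: "finitely_generated_in H N" and ND: "N \<subseteq> D"
  shows "finite (support I \<Omega> N)"
proof -
  obtain S where S: "finite S" "S \<subseteq> N" "generate H S = N"
    using fg unfolding finitely_generated_in_def by blast
  note [simp] = group.is_monoid[OF group_factor] group.is_group[OF group_factor]
    monoid.inv_one[OF group.is_monoid[OF group_factor]]
  let ?J = "\<Union>s\<in>S. {i \<in> I. s i \<noteq> \<one>\<^bsub>\<Omega> i\<^esub>}"
  have "finite {i \<in> I. s i \<noteq> \<one>\<^bsub>\<Omega> i\<^esub>}" if "s \<in> S" for s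
  proof -
    have "s \<in> D" using that S(2) ND by blast
    then show ?thesis by (simp add: D_iff)
  qed
  then have "finite ?J" using S(1) by simp
  moreover have "\<forall>i\<in>I - ?J. x i = \<one>\<^bsub>\<Omega> i\<^esub>" if "x \<in> generate H S" for x
    using that
  proof induction
    case (inv h)
    then have "h \<in> K" using S ND sum_le_K by blast
    then show ?case using inv by (auto simp: inv_K)
  qed auto
  then have "support I \<Omega> N \<subseteq> ?J"
    unfolding support_def S(3) by blast
  ultimately show ?thesis by (rule finite_subset[rotated])
qed

text \<open>
  The two cases of the dichotomy call for different ambient groups \<open>L\<close> of the complement: the whole
  group when \<open>N\<close> has finite support, the direct sum when \<open>N\<close> covers the quotient.
\<close>
lemma direct_factor_if_finitely_generated_normal:
  assumes N: "N \<lhd> H" and fg: "finitely_generated_in H N" and Q: "simple_grp (H Mod D)"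
  shows "direct_factor H N"
proof -
  consider "N \<subseteq> D" | "carrier H \<subseteq> N <#>\<^bsub>H\<^esub> D"
    using normal.simple_quotient_dichotomy[OF D_normal Q N] by blast
  then show ?thesis
  proof cases
    case 1
    show ?thesis
    proof (rule direct_factorI[OF N H.normal_self])
      show "D \<subseteq> carrier H" using sum_le_K by simp
      show "finite {i \<in> support I \<Omega> N. d i \<noteq> \<one>\<^bsub>\<Omega> i\<^esub>}" for d
        using finite_support_if_finitely_generated[OF fg 1] by simp
      show "K \<subseteq> N <#>\<^bsub>H\<^esub> carrier H"
      proof
        fix x assume "x \<in> K"
        then have "x = \<one>\<^bsub>H\<^esub> \<otimes>\<^bsub>H\<^esub> x" "x \<in> carrier H" using H.l_one[of x] by simp_all
        moreover have "\<one>\<^bsub>H\<^esub> \<in> N" using N by (metis normal_imp_subgroup subgroup.one_closed)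
        ultimately show "x \<in> N <#>\<^bsub>H\<^esub> carrier H" unfolding set_mult_def by blast
      qed
    qed
  next
    case 2
    show ?thesis
    proof (rule direct_factorI[OF N D_normal])
      show "finite {i \<in> support I \<Omega> N. d i \<noteq> \<one>\<^bsub>\<Omega> i\<^esub>}" if "d \<in> D" for d
      proof -
        have "{i \<in> support I \<Omega> N. d i \<noteq> \<one>\<^bsub>\<Omega> i\<^esub>} \<subseteq> {i \<in> I. d i \<noteq> \<one>\<^bsub>\<Omega> i\<^esub>}"
          by (auto simp: support_def)
        then show ?thesis using that D_iff finite_subset by blast
      qed
      show "K \<subseteq> N <#>\<^bsub>H\<^esub> D" using 2 by simp
    qed simp
  qed
qed

end

section \<open>Coordinates in a telescope\<close>

context telescope
begin

abbreviation P where "P \<equiv> tel_product \<Omega>"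

sublocale B: group B by (rule group_B)

sublocale P: group P by (rule product_group) (simp add: group_\<Omega>)

lemma \<iota>_hom_le: "1 \<le> i \<Longrightarrow> i \<le> j \<Longrightarrow> \<iota> i j \<in> hom (\<Omega> i) (\<Omega> j)"
proof (cases "i = j")
  case True
  assume "1 \<le> i"
  then show ?thesis using \<iota>_id group_\<Omega>[of i] True
    by (auto simp: hom_def monoid.m_closed[OF group.is_monoid])
qed (simp add: \<iota>_hom)

lemma \<iota>_comp_le:
  assumes "1 \<le> i" "i \<le> j" "j \<le> k" "x \<in> carrier (\<Omega> i)"
  shows "\<iota> j k (\<iota> i j x) = \<iota> i k x"
proof (cases "i = j \<or> j = k")
  case True
  have "\<iota> i j x \<in> carrier (\<Omega> j)" using \<iota>_hom_le[of i j] assms by (auto simp: hom_def)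
  then show ?thesis using True assms \<iota>_id by auto
qed (use assms \<iota>_comp in auto)

lemma \<iota>_group_hom: "1 \<le> i \<Longrightarrow> i \<le> j \<Longrightarrow> group_hom (\<Omega> i) (\<Omega> j) (\<iota> i j)"
  by (simp add: group_hom_def group_hom_axioms_def group_\<Omega> \<iota>_hom_le)

lemma \<phi>_group_hom: "2 \<le> k \<Longrightarrow> group_hom B (\<Omega> k) (\<phi> k)"
  by (simp add: group_hom_def group_hom_axioms_def group_\<Omega> group_B \<phi>_hom)

lemma \<phi>_closed: "2 \<le> k \<Longrightarrow> g \<in> carrier B \<Longrightarrow> \<phi> k g \<in> carrier (\<Omega> k)"
  using \<phi>_hom by (auto simp: hom_def)

lemma \<iota>_closed: "1 \<le> i \<Longrightarrow> i \<le> j \<Longrightarrow> x \<in> carrier (\<Omega> i) \<Longrightarrow> \<iota> i j x \<in> carrier (\<Omega> j)"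
  using \<iota>_hom_le by (auto simp: hom_def)

lemma \<iota>_commute:
  assumes "1 \<le> i" "i \<le> j" "x \<in> carrier (\<Omega> i)" "y \<in> carrier (\<Omega> i)"
    and "x \<otimes>\<^bsub>\<Omega> i\<^esub> y = y \<otimes>\<^bsub>\<Omega> i\<^esub> x"
  shows "\<iota> i j x \<otimes>\<^bsub>\<Omega> j\<^esub> \<iota> i j y = \<iota> i j y \<otimes>\<^bsub>\<Omega> j\<^esub> \<iota> i j x"
  using assms \<iota>_hom_le[of i j] by (metis hom_mult)

lemma image_closed: "2 \<le> k \<Longrightarrow> k \<le> m \<Longrightarrow> g \<in> carrier B \<Longrightarrow> \<iota> k m (\<phi> k g) \<in> carrier (\<Omega> m)"
  using \<iota>_closed \<phi>_closed by simp

lemma image_mult: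
  assumes "2 \<le> k" "k \<le> m" "g \<in> carrier B" "h \<in> carrier B"
  shows "\<iota> k m (\<phi> k (g \<otimes>\<^bsub>B\<^esub> h)) = \<iota> k m (\<phi> k g) \<otimes>\<^bsub>\<Omega> m\<^esub> \<iota> k m (\<phi> k h)"
  using assms hom_mult[OF \<phi>_hom] hom_mult[OF \<iota>_hom_le[of k m]] \<phi>_closed by simp

lemma image_commute_less:
  assumes "2 \<le> k" "k < l" "l \<le> m" "g \<in> carrier B" "h \<in> carrier B"
  shows "\<iota> k m (\<phi> k g) \<otimes>\<^bsub>\<Omega> m\<^esub> \<iota> l m (\<phi> l h) = \<iota> l m (\<phi> l h) \<otimes>\<^bsub>\<Omega> m\<^esub> \<iota> k m (\<phi> k g)"
proof -
  have c: "\<iota> k l (\<phi> k g) \<in> carrier (\<Omega> l)" "\<phi> l h \<in> carrier (\<Omega> l)"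
    using assms image_closed \<phi>_closed by auto
  have "\<iota> k l (\<phi> k g) \<otimes>\<^bsub>\<Omega> l\<^esub> \<phi> l h = \<phi> l h \<otimes>\<^bsub>\<Omega> l\<^esub> \<iota> k l (\<phi> k g)"
    by (rule group.commutator_subgroup_trivialD[OF group_\<Omega> images_commute[OF assms(1,2)]])
      (use assms c in \<open>auto simp: tel_image_def\<close>)
  then have "\<iota> l m (\<iota> k l (\<phi> k g)) \<otimes>\<^bsub>\<Omega> m\<^esub> \<iota> l m (\<phi> l h) = \<iota> l m (\<phi> l h) \<otimes>\<^bsub>\<Omega> m\<^esub> \<iota> l m (\<iota> k l (\<phi> k g))"
    using \<iota>_commute[of l m] c assms by simp
  moreover have "\<iota> l m (\<iota> k l (\<phi> k g)) = \<iota> k m (\<phi> k g)"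
    by (rule \<iota>_comp_le) (use assms \<phi>_closed in auto)
  ultimately show ?thesis by simp
qed

lemma image_commute:
  assumes "2 \<le> k" "2 \<le> l" "k \<noteq> l" "k \<le> m" "l \<le> m" "g \<in> carrier B" "h \<in> carrier B"
  shows "\<iota> k m (\<phi> k g) \<otimes>\<^bsub>\<Omega> m\<^esub> \<iota> l m (\<phi> l h) = \<iota> l m (\<phi> l h) \<otimes>\<^bsub>\<Omega> m\<^esub> \<iota> k m (\<phi> k g)"
  using assms image_commute_less[of k l m g h] image_commute_less[of l k m h g]
  by (cases "k < l") auto

text \<open>
  The \<open>B\<close>-diagonal above level \<open>r\<close>: the analogue of \<^const>\<open>tel_tilde\<close>, which is the case \<open>r = 1\<close>, with
  the levels up to \<open>r\<close> removed. The list of levels is empty at the coordinates \<open>i \<le> r\<close>.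
\<close>
definition tail :: "nat \<Rightarrow> 'b \<Rightarrow> nat \<Rightarrow> 'a" where
  "tail r g = (\<lambda>i\<in>{1..}. foldr (\<lambda>k x. \<iota> k i (\<phi> k g) \<otimes>\<^bsub>\<Omega> i\<^esub> x) [r + 1..<i + 1] \<one>\<^bsub>\<Omega> i\<^esub>)"

lemma tail_one: "tel_tilde \<Omega> \<iota> \<phi> = tail 1"
  by (simp add: tel_tilde_def tail_def fun_eq_iff numeral_2_eq_2)

lemma tail_trivial: "1 \<le> i \<Longrightarrow> i \<le> r \<Longrightarrow> tail r g i = \<one>\<^bsub>\<Omega> i\<^esub>"
  by (simp add: tail_def)

lemma tail_rec: "r < i \<Longrightarrow> tail r g i = \<iota> (Suc r) i (\<phi> (Suc r) g) \<otimes>\<^bsub>\<Omega> i\<^esub> tail (Suc r) g i"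
  by (simp add: tail_def upt_conv_Cons del: upt_Suc)

text \<open>
  Downward induction on the level where a tail starts, beginning at the levels \<open>r \<ge> i\<close> at which the
  coordinate \<open>i\<close> of the tail is trivial.
\<close>
lemma tail_induct [consumes 1, case_names trivial step]:
  assumes "1 \<le> r" "\<And>r. 1 \<le> r \<Longrightarrow> i \<le> r \<Longrightarrow> Q r"
    and "\<And>r. 1 \<le> r \<Longrightarrow> r < i \<Longrightarrow> Q (Suc r) \<Longrightarrow> Q r"
  shows "Q (r::nat)"
  using assms(1)
proof (induction "i - r" arbitrary: r)
  case 0 then show ?case using assms(2) by simp
next
  case (Suc n)
  then show ?case using assms(3)[of r] by simp
qed

lemma tail_closed:
  assumes "1 \<le> r" "1 \<le> i" "g \<in> carrier B"
  shows "tail r g i \<in> carrier (\<Omega> i)"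
  using assms(1)
proof (induction r rule: tail_induct[where i = i])
  case (trivial r)
  then show ?case using assms group_\<Omega> by (simp add: tail_trivial group.is_monoid)
next
  case (step r)
  interpret Oi: group "\<Omega> i" using assms group_\<Omega> by simp
  show ?case using step assms by (simp add: tail_rec image_closed)
qed

lemma commute_tail:
  assumes "1 \<le> r" "1 \<le> i" "g \<in> carrier B" and c: "c \<in> carrier (\<Omega> i)"
    and "\<And>k. r < k \<Longrightarrow> k \<le> i \<Longrightarrow>
           c \<otimes>\<^bsub>\<Omega> i\<^esub> \<iota> k i (\<phi> k g) = \<iota> k i (\<phi> k g) \<otimes>\<^bsub>\<Omega> i\<^esub> c"
  shows "c \<otimes>\<^bsub>\<Omega> i\<^esub> tail r g i = tail r g i \<otimes>\<^bsub>\<Omega> i\<^esub> c"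
  using assms(1,5)
proof (induction r rule: tail_induct[where i = i])
  case (trivial r)
  interpret Oi: group "\<Omega> i" using assms group_\<Omega> by simp
  from trivial show ?case using assms by (simp add: tail_trivial)
next
  case (step r)
  interpret Oi: group "\<Omega> i" using assms group_\<Omega> by simp
  let ?b = "\<iota> (Suc r) i (\<phi> (Suc r) g)" and ?t = "tail (Suc r) g i"
  have b: "?b \<in> carrier (\<Omega> i)" and t: "?t \<in> carrier (\<Omega> i)"
    using step.hyps assms by (auto intro: image_closed tail_closed)
  have "c \<otimes>\<^bsub>\<Omega> i\<^esub> (?b \<otimes>\<^bsub>\<Omega> i\<^esub> ?t) = (?b \<otimes>\<^bsub>\<Omega> i\<^esub> c) \<otimes>\<^bsub>\<Omega> i\<^esub> ?t"
    using step.prems[of "Suc r"] step.hyps c b t by (simp flip: Oi.m_assoc)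
  also have "\<dots> = ?b \<otimes>\<^bsub>\<Omega> i\<^esub> (?t \<otimes>\<^bsub>\<Omega> i\<^esub> c)"
    using step.IH step.prems c b t by (simp add: Oi.m_assoc)
  finally show ?case using step.hyps c b t by (simp add: tail_rec Oi.m_assoc)
qed

text \<open>
  The level \<open>r + 1\<close> factor of \<open>h\<close> has to pass the higher levels of \<open>g\<close>; it does because images of
  \<open>B\<close> from different levels commute.
\<close>
lemma tail_mult_coordinate:
  assumes "1 \<le> r" "1 \<le> i" "g \<in> carrier B" "h \<in> carrier B"
  shows "tail r (g \<otimes>\<^bsub>B\<^esub> h) i = tail r g i \<otimes>\<^bsub>\<Omega> i\<^esub> tail r h i"
  using assms(1)
proof (induction r rule: tail_induct[where i = i])
  case (trivial r)
  interpret Oi: group "\<Omega> i" using assms group_\<Omega> by simp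
  from trivial show ?case using assms by (simp add: tail_trivial)
next
  case (step r)
  interpret Oi: group "\<Omega> i" using assms group_\<Omega> by simp
  let ?b = "\<lambda>g. \<iota> (Suc r) i (\<phi> (Suc r) g)" and ?t = "\<lambda>g. tail (Suc r) g i"
  have c: "?b g \<in> carrier (\<Omega> i)" "?t g \<in> carrier (\<Omega> i)"
    "?b h \<in> carrier (\<Omega> i)" "?t h \<in> carrier (\<Omega> i)"
    using step.hyps assms by (auto intro: image_closed tail_closed)
  have comm: "?b h \<otimes>\<^bsub>\<Omega> i\<^esub> ?t g = ?t g \<otimes>\<^bsub>\<Omega> i\<^esub> ?b h"
    by (rule commute_tail) (use step.hyps assms c in \<open>auto intro: image_commute\<close>)
  have "tail r (g \<otimes>\<^bsub>B\<^esub> h) i = (?b g \<otimes>\<^bsub>\<Omega> i\<^esub> ?b h) \<otimes>\<^bsub>\<Omega> i\<^esub> (?t g \<otimes>\<^bsub>\<Omega> i\<^esub> ?t h)"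
    using step assms by (simp add: tail_rec image_mult)
  also have "\<dots> = ?b g \<otimes>\<^bsub>\<Omega> i\<^esub> (?b h \<otimes>\<^bsub>\<Omega> i\<^esub> ?t g) \<otimes>\<^bsub>\<Omega> i\<^esub> ?t h"
    using c by (simp add: Oi.m_assoc)
  also have "\<dots> = (?b g \<otimes>\<^bsub>\<Omega> i\<^esub> ?t g) \<otimes>\<^bsub>\<Omega> i\<^esub> (?b h \<otimes>\<^bsub>\<Omega> i\<^esub> ?t h)"
    unfolding comm using c by (simp add: Oi.m_assoc)
  finally show ?case using step.hyps by (simp add: tail_rec)
qed

lemma tail_hom:
  assumes "1 \<le> r"
  shows "tail r \<in> hom B P"
proof (rule homI)
  show c: "tail r g \<in> carrier P" if "g \<in> carrier B" for g
    using tail_closed[OF assms _ that] by (auto simp: PiE_iff tail_def extensional_def)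
  show "tail r (g \<otimes>\<^bsub>B\<^esub> h) = tail r g \<otimes>\<^bsub>P\<^esub> tail r h" if "g \<in> carrier B" "h \<in> carrier B" for g h
  proof
    fix i show "tail r (g \<otimes>\<^bsub>B\<^esub> h) i = (tail r g \<otimes>\<^bsub>P\<^esub> tail r h) i"
      using tail_mult_coordinate[OF assms _ that] by (cases "1 \<le> i") (auto simp: tail_def)
  qed
qed

lemma diag_coordinate:
  "1 \<le> j \<Longrightarrow> tel_diag \<Omega> \<iota> i w j = (if j < i then \<one>\<^bsub>\<Omega> j\<^esub> else \<iota> i j w)"
  by (simp add: tel_diag_def)

lemma diag_hom:
  assumes "1 \<le> i"
  shows "tel_diag \<Omega> \<iota> i \<in> hom (\<Omega> i) P"
proof (rule homI)
  show "tel_diag \<Omega> \<iota> i w \<in> carrier P" if "w \<in> carrier (\<Omega> i)" for w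
    using that assms \<iota>_closed by (auto simp: tel_diag_def group.is_monoid[OF group_\<Omega>])
  show "tel_diag \<Omega> \<iota> i (v \<otimes>\<^bsub>\<Omega> i\<^esub> w) = tel_diag \<Omega> \<iota> i v \<otimes>\<^bsub>P\<^esub> tel_diag \<Omega> \<iota> i w"
    if "v \<in> carrier (\<Omega> i)" "w \<in> carrier (\<Omega> i)" for v w
  proof
    fix j show "tel_diag \<Omega> \<iota> i (v \<otimes>\<^bsub>\<Omega> i\<^esub> w) j = (tel_diag \<Omega> \<iota> i v \<otimes>\<^bsub>P\<^esub> tel_diag \<Omega> \<iota> i w) j"
      using that assms hom_mult[OF \<iota>_hom_le[of i j]] group.is_monoid[OF group_\<Omega>[of j]]
      by (auto simp: tel_diag_def)
  qed
qed

lemma diag_group_hom: "1 \<le> i \<Longrightarrow> group_hom (\<Omega> i) P (tel_diag \<Omega> \<iota> i)"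
  by (intro group_hom.intro group_\<Omega> P.is_group) (simp_all only: group_hom_axioms_def diag_hom)

lemma tail_group_hom: "1 \<le> r \<Longrightarrow> group_hom B P (tail r)"
  by (intro group_hom.intro group_B P.is_group) (simp_all only: group_hom_axioms_def tail_hom)

lemma diag_closed: "1 \<le> i \<Longrightarrow> w \<in> carrier (\<Omega> i) \<Longrightarrow> tel_diag \<Omega> \<iota> i w \<in> carrier P"
  using diag_hom by (rule hom_in_carrier)

lemma tail_carrier: "1 \<le> r \<Longrightarrow> g \<in> carrier B \<Longrightarrow> tail r g \<in> carrier P"
  using tail_hom by (rule hom_in_carrier)

lemma P_eqI:
  "x \<in> carrier P \<Longrightarrow> y \<in> carrier P \<Longrightarrow> (\<And>i. 1 \<le> i \<Longrightarrow> x i = y i) \<Longrightarrow> x = y"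
  by (auto intro: PiE_ext)

lemma P_mult: "1 \<le> i \<Longrightarrow> (x \<otimes>\<^bsub>P\<^esub> y) i = x i \<otimes>\<^bsub>\<Omega> i\<^esub> y i"
  by simp

lemma P_inv: "1 \<le> i \<Longrightarrow> x \<in> carrier P \<Longrightarrow> (inv\<^bsub>P\<^esub> x) i = inv\<^bsub>\<Omega> i\<^esub> x i"
  using inv_product_group[of x "{1..}" \<Omega>] group_\<Omega> by simp

lemma diag_mult_tail:
  assumes "1 \<le> r" "g \<in> carrier B"
  shows "tail r g = tel_diag \<Omega> \<iota> (Suc r) (\<phi> (Suc r) g) \<otimes>\<^bsub>P\<^esub> tail (Suc r) g"
proof (rule P_eqI)
  show "tail r g \<in> carrier P" using assms by (rule tail_carrier)
  show "tel_diag \<Omega> \<iota> (Suc r) (\<phi> (Suc r) g) \<otimes>\<^bsub>P\<^esub> tail (Suc r) g \<in> carrier P"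
    by (intro P.m_closed diag_closed tail_carrier \<phi>_closed) (use assms in auto)
  show "tail r g i = (tel_diag \<Omega> \<iota> (Suc r) (\<phi> (Suc r) g) \<otimes>\<^bsub>P\<^esub> tail (Suc r) g) i" if "1 \<le> i" for i
    unfolding P_mult[OF that]
    using that group.is_monoid[OF group_\<Omega>[OF that]]
    by (cases "r < i") (auto simp: tail_rec tail_trivial diag_coordinate)
qed

lemma single_eq_diag:
  assumes "1 \<le> i" "w \<in> carrier (\<Omega> i)"
  shows "single {1..} \<Omega> i w = tel_diag \<Omega> \<iota> i w \<otimes>\<^bsub>P\<^esub> inv\<^bsub>P\<^esub> tel_diag \<Omega> \<iota> (Suc i) (\<iota> i (Suc i) w)"
    (is "?s = ?d \<otimes>\<^bsub>P\<^esub> inv\<^bsub>P\<^esub> ?e")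
proof (rule P_eqI)
  have d: "?d \<in> carrier P" and e: "?e \<in> carrier P"
    using assms \<iota>_closed[of i "Suc i" w] diag_closed[of i] diag_closed[of "Suc i"] by auto
  show "?s \<in> carrier P"
    using assms by (auto simp: single_def group.is_monoid[OF group_\<Omega>])
  show "?d \<otimes>\<^bsub>P\<^esub> inv\<^bsub>P\<^esub> ?e \<in> carrier P" using d e by (intro P.m_closed P.inv_closed)
  show "?s j = (?d \<otimes>\<^bsub>P\<^esub> inv\<^bsub>P\<^esub> ?e) j" if j: "1 \<le> j" for j
  proof -
    interpret Oj: group "\<Omega> j" using group_\<Omega> j .
    interpret Oi: group "\<Omega> i" using group_\<Omega> assms(1) .
    have "\<iota> i j w \<in> carrier (\<Omega> j)" if "i \<le> j" using \<iota>_closed assms that by simp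
    then show ?thesis
      unfolding P_mult[OF j] P_inv[OF j e]
      using j assms \<iota>_comp_le[of i "Suc i" j w] \<iota>_id[of i w]
      by (auto simp: single_def diag_coordinate not_less_eq not_less)
  qed
qed

end

section \<open>The group of a flexible telescope contains all diagonals\<close>

context flexible_telescope
begin

text \<open>
  The diagonal copy of the commutator is itself a commutator in the given subgroup, between the
  conjugate \<open>y\<close> of one \<open>B\<close>-diagonal above level \<open>r\<close> and another such diagonal \<open>z\<close>. The element \<open>A\<close>
  that conjugates is the diagonal copy of the flexibility element \<open>\<alpha> r\<close>.
\<close>
lemma diag_of_commutator_in_subgroup:
  assumes r: "1 \<le> r" and K: "subgroup K P"
    and dK: "\<And>w. w \<in> carrier (\<Omega> r) \<Longrightarrow> tel_diag \<Omega> \<iota> r w \<in> K"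
    and tK: "\<And>g. g \<in> carrier B \<Longrightarrow> tail r g \<in> K"
    and g: "g \<in> carrier B" and h: "h \<in> carrier B"
  shows "tel_diag \<Omega> \<iota> (Suc r) (\<phi> (Suc r) (g \<otimes>\<^bsub>B\<^esub> h \<otimes>\<^bsub>B\<^esub> inv\<^bsub>B\<^esub> g \<otimes>\<^bsub>B\<^esub> inv\<^bsub>B\<^esub> h)) \<in> K"
proof -
  obtain \<alpha> where "\<forall>i\<ge>1. \<alpha> i \<in> carrier (\<Omega> i)"
    and \<alpha>_next: "\<forall>i\<ge>1. commutator_subgroup (\<Omega> (i + 1)) {\<iota> i (i + 1) (\<alpha> i)} (\<phi> (i + 1) ` carrier B)
              = {\<one>\<^bsub>\<Omega> (i + 1)\<^esub>}"
    and \<alpha>_conj: "\<forall>i\<ge>1. \<forall>k\<ge>i + 2. \<forall>l\<ge>i + 2. \<forall>m\<ge>max k l.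
       commutator_subgroup (\<Omega> m)
         (conj_set (\<Omega> m) (tel_image B \<iota> \<phi> k m) (\<iota> i m (\<alpha> i)))
         (tel_image B \<iota> \<phi> l m) = {\<one>\<^bsub>\<Omega> m\<^esub>}"
    using flexible by (elim exE conjE) (rule that)
  then have \<alpha>: "\<alpha> r \<in> carrier (\<Omega> r)" using r by blast
  let ?a = "\<lambda>m. \<iota> r m (\<alpha> r)"
  have a: "?a m \<in> carrier (\<Omega> m)" if "r \<le> m" for m using \<iota>_closed r \<alpha> that by simp
  \<comment> \<open>the first flexibility condition, pushed from level \<open>r + 1\<close> to all higher levels\<close>
  have a_comm: "?a m \<otimes>\<^bsub>\<Omega> m\<^esub> \<iota> (Suc r) m (\<phi> (Suc r) g) = \<iota> (Suc r) m (\<phi> (Suc r) g) \<otimes>\<^bsub>\<Omega> m\<^esub> ?a m"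
    if m: "r < m" and g: "g \<in> carrier B" for m g
  proof -
    have c: "?a (Suc r) \<in> carrier (\<Omega> (Suc r))" "\<phi> (Suc r) g \<in> carrier (\<Omega> (Suc r))"
      using a g \<phi>_closed r by auto
    have "?a (Suc r) \<otimes>\<^bsub>\<Omega> (Suc r)\<^esub> \<phi> (Suc r) g = \<phi> (Suc r) g \<otimes>\<^bsub>\<Omega> (Suc r)\<^esub> ?a (Suc r)"
      by (rule group.commutator_subgroup_trivialD[OF group_\<Omega> \<alpha>_next[rule_format, OF r, unfolded Suc_eq_plus1[symmetric]]])
        (use c g in auto)
    from \<iota>_commute[OF _ _ c this, of m]
    show ?thesis using m r \<alpha> \<iota>_comp_le[of r "Suc r" m "\<alpha> r"] by simp
  qed
  \<comment> \<open>the second flexibility condition, first for single levels and then for the whole tails\<close>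
  have conj_comm: "(inv\<^bsub>\<Omega> m\<^esub> ?a m \<otimes>\<^bsub>\<Omega> m\<^esub> \<iota> k m (\<phi> k g) \<otimes>\<^bsub>\<Omega> m\<^esub> ?a m) \<otimes>\<^bsub>\<Omega> m\<^esub> \<iota> l m (\<phi> l h)
      = \<iota> l m (\<phi> l h) \<otimes>\<^bsub>\<Omega> m\<^esub> (inv\<^bsub>\<Omega> m\<^esub> ?a m \<otimes>\<^bsub>\<Omega> m\<^esub> \<iota> k m (\<phi> k g) \<otimes>\<^bsub>\<Omega> m\<^esub> ?a m)"
    if "r + 2 \<le> k" "r + 2 \<le> l" "k \<le> m" "l \<le> m" "g \<in> carrier B" "h \<in> carrier B" for k l m g h
  proof -
    interpret Om: group "\<Omega> m" using group_\<Omega> that by simp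
    have c: "?a m \<in> carrier (\<Omega> m)" "\<iota> k m (\<phi> k g) \<in> carrier (\<Omega> m)" "\<iota> l m (\<phi> l h) \<in> carrier (\<Omega> m)"
      using that a image_closed by auto
    show ?thesis
      by (rule Om.commutator_subgroup_trivialD[OF \<alpha>_conj[rule_format, OF r that(1,2)]])
        (use that c in \<open>auto simp: conj_set_def tel_image_def\<close>)
  qed
  have conj_tail: "(inv\<^bsub>\<Omega> m\<^esub> ?a m \<otimes>\<^bsub>\<Omega> m\<^esub> tail (Suc r) g m \<otimes>\<^bsub>\<Omega> m\<^esub> ?a m) \<otimes>\<^bsub>\<Omega> m\<^esub> tail (Suc r) h m
      = tail (Suc r) h m \<otimes>\<^bsub>\<Omega> m\<^esub> (inv\<^bsub>\<Omega> m\<^esub> ?a m \<otimes>\<^bsub>\<Omega> m\<^esub> tail (Suc r) g m \<otimes>\<^bsub>\<Omega> m\<^esub> ?a m)"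
    if m: "r < m" for m
  proof -
    have m1: "1 \<le> m" using m r by simp
    interpret Om: group "\<Omega> m" using group_\<Omega> m1 .
    have am: "?a m \<in> carrier (\<Omega> m)" using a m by simp
    have t: "tail (Suc r) g m \<in> carrier (\<Omega> m)" "tail (Suc r) h m \<in> carrier (\<Omega> m)"
      using tail_closed m1 g h by auto
    let ?q = "?a m \<otimes>\<^bsub>\<Omega> m\<^esub> tail (Suc r) h m \<otimes>\<^bsub>\<Omega> m\<^esub> inv\<^bsub>\<Omega> m\<^esub> ?a m"
    have "?q \<otimes>\<^bsub>\<Omega> m\<^esub> tail (Suc r) g m = tail (Suc r) g m \<otimes>\<^bsub>\<Omega> m\<^esub> ?q"
    proof (rule commute_tail)
      show "?q \<in> carrier (\<Omega> m)" using t am by simp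
      fix k assume k: "Suc r < k" "k \<le> m"
      let ?b = "\<iota> k m (\<phi> k g)"
      have b: "?b \<in> carrier (\<Omega> m)" using image_closed k g r by simp
      have "(inv\<^bsub>\<Omega> m\<^esub> ?a m \<otimes>\<^bsub>\<Omega> m\<^esub> ?b \<otimes>\<^bsub>\<Omega> m\<^esub> ?a m) \<otimes>\<^bsub>\<Omega> m\<^esub> tail (Suc r) h m
          = tail (Suc r) h m \<otimes>\<^bsub>\<Omega> m\<^esub> (inv\<^bsub>\<Omega> m\<^esub> ?a m \<otimes>\<^bsub>\<Omega> m\<^esub> ?b \<otimes>\<^bsub>\<Omega> m\<^esub> ?a m)"
        by (rule commute_tail) (use k g h b am m1 conj_comm in auto)
      then show "?q \<otimes>\<^bsub>\<Omega> m\<^esub> ?b = ?b \<otimes>\<^bsub>\<Omega> m\<^esub> ?q"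
        using Om.commute_conj_iff[OF am b t(2)] by simp
    qed (use m1 g in auto)
    then show ?thesis using Om.commute_conj_iff[OF am t] by simp
  qed
  let ?gh = "g \<otimes>\<^bsub>B\<^esub> h \<otimes>\<^bsub>B\<^esub> inv\<^bsub>B\<^esub> g \<otimes>\<^bsub>B\<^esub> inv\<^bsub>B\<^esub> h"
  define A where "A = tel_diag \<Omega> \<iota> r (\<alpha> r)"
  define y where "y = inv\<^bsub>P\<^esub> A \<otimes>\<^bsub>P\<^esub> tail r g \<otimes>\<^bsub>P\<^esub> A"
  define z where "z = tail r h"
  have A: "A \<in> carrier P" unfolding A_def using diag_closed r \<alpha> by blast
  have tg: "tail r g \<in> carrier P" using tail_carrier r g by blast
  have z: "z \<in> carrier P" unfolding z_def using tail_carrier r h by blast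
  have y: "y \<in> carrier P" unfolding y_def using A tg by (intro P.m_closed P.inv_closed)
  have gh: "?gh \<in> carrier B" using g h by simp
  have "y \<otimes>\<^bsub>P\<^esub> z \<otimes>\<^bsub>P\<^esub> inv\<^bsub>P\<^esub> y \<otimes>\<^bsub>P\<^esub> inv\<^bsub>P\<^esub> z = tel_diag \<Omega> \<iota> (Suc r) (\<phi> (Suc r) ?gh)"
  proof (rule P_eqI)
    show "y \<otimes>\<^bsub>P\<^esub> z \<otimes>\<^bsub>P\<^esub> inv\<^bsub>P\<^esub> y \<otimes>\<^bsub>P\<^esub> inv\<^bsub>P\<^esub> z \<in> carrier P"
      using y z by (intro P.m_closed P.inv_closed)
    show "tel_diag \<Omega> \<iota> (Suc r) (\<phi> (Suc r) ?gh) \<in> carrier P"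
      by (intro diag_closed \<phi>_closed) (use r gh in auto)
    fix m :: nat assume m1: "1 \<le> m"
    interpret Om: group "\<Omega> m" using group_\<Omega> m1 .
    have ym: "y m = inv\<^bsub>\<Omega> m\<^esub> A m \<otimes>\<^bsub>\<Omega> m\<^esub> tail r g m \<otimes>\<^bsub>\<Omega> m\<^esub> A m"
      unfolding y_def by (simp only: P_mult[OF m1] P_inv[OF m1 A])
    have lhs: "(y \<otimes>\<^bsub>P\<^esub> z \<otimes>\<^bsub>P\<^esub> inv\<^bsub>P\<^esub> y \<otimes>\<^bsub>P\<^esub> inv\<^bsub>P\<^esub> z) m
        = y m \<otimes>\<^bsub>\<Omega> m\<^esub> z m \<otimes>\<^bsub>\<Omega> m\<^esub> inv\<^bsub>\<Omega> m\<^esub> y m \<otimes>\<^bsub>\<Omega> m\<^esub> inv\<^bsub>\<Omega> m\<^esub> z m"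
      by (simp only: P_mult[OF m1] P_inv[OF m1 y] P_inv[OF m1 z])
    show "(y \<otimes>\<^bsub>P\<^esub> z \<otimes>\<^bsub>P\<^esub> inv\<^bsub>P\<^esub> y \<otimes>\<^bsub>P\<^esub> inv\<^bsub>P\<^esub> z) m = tel_diag \<Omega> \<iota> (Suc r) (\<phi> (Suc r) ?gh) m"
    proof (cases "r < m")
      case False
      have "A m \<in> carrier (\<Omega> m)" using A m1 by (auto simp: PiE_iff)
      then show ?thesis
        unfolding lhs ym using False m1 by (simp add: tail_trivial z_def diag_coordinate)
    next
      case True
      let ?b = "\<lambda>g. \<iota> (Suc r) m (\<phi> (Suc r) g)"
      have b: "?b g \<in> carrier (\<Omega> m)" "?b h \<in> carrier (\<Omega> m)"
        using image_closed r True g h by auto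
      have t: "tail (Suc r) g m \<in> carrier (\<Omega> m)" "tail (Suc r) h m \<in> carrier (\<Omega> m)"
        using tail_closed m1 g h by auto
      have am: "?a m \<in> carrier (\<Omega> m)" using a True by simp
      have bt: "?b u \<otimes>\<^bsub>\<Omega> m\<^esub> tail (Suc r) v m = tail (Suc r) v m \<otimes>\<^bsub>\<Omega> m\<^esub> ?b u"
        if "u \<in> carrier B" "v \<in> carrier B" for u v
        by (rule commute_tail) (use that r True m1 in \<open>auto intro: image_commute image_closed\<close>)
      have Am: "A m = ?a m" using True m1 by (simp add: A_def diag_coordinate)
      have "(y \<otimes>\<^bsub>P\<^esub> z \<otimes>\<^bsub>P\<^esub> inv\<^bsub>P\<^esub> y \<otimes>\<^bsub>P\<^esub> inv\<^bsub>P\<^esub> z) m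
          = ?b g \<otimes>\<^bsub>\<Omega> m\<^esub> ?b h \<otimes>\<^bsub>\<Omega> m\<^esub> inv\<^bsub>\<Omega> m\<^esub> ?b g \<otimes>\<^bsub>\<Omega> m\<^esub> inv\<^bsub>\<Omega> m\<^esub> ?b h"
        unfolding lhs unfolding ym z_def Am tail_rec[OF True]
        by (rule Om.commutator_of_commuting_parts[OF b t am])
          (use a_comm[OF True] bt conj_tail[OF True] g h in auto)
      also have "\<dots> = ?b ?gh"
      proof -
        interpret b: group_hom B "\<Omega> m" ?b
          by (rule group_hom.intro[OF group_B Om.is_group], unfold group_hom_axioms_def, rule homI)
            (use image_closed image_mult r True in auto)
        show ?thesis using g h by simp
      qed
      finally show ?thesis using True m1 by (simp add: diag_coordinate)
    qed
  qed
  moreover have "y \<otimes>\<^bsub>P\<^esub> z \<otimes>\<^bsub>P\<^esub> inv\<^bsub>P\<^esub> y \<otimes>\<^bsub>P\<^esub> inv\<^bsub>P\<^esub> z \<in> K"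
    unfolding y_def z_def A_def
    by (intro subgroup.m_closed[OF K] subgroup.m_inv_closed[OF K] dK tK \<alpha> g h)
  ultimately show ?thesis by (simp only:)
qed

lemma diag_conj:
  assumes r: "1 \<le> r" and v: "v \<in> carrier (\<Omega> r)" and b: "b \<in> carrier (\<Omega> (Suc r))"
  shows "tel_diag \<Omega> \<iota> (Suc r) (\<iota> r (Suc r) v \<otimes>\<^bsub>\<Omega> (Suc r)\<^esub> b \<otimes>\<^bsub>\<Omega> (Suc r)\<^esub> inv\<^bsub>\<Omega> (Suc r)\<^esub> \<iota> r (Suc r) v)
    = tel_diag \<Omega> \<iota> r v \<otimes>\<^bsub>P\<^esub> tel_diag \<Omega> \<iota> (Suc r) b \<otimes>\<^bsub>P\<^esub> inv\<^bsub>P\<^esub> tel_diag \<Omega> \<iota> r v"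
    (is "?l = ?d \<otimes>\<^bsub>P\<^esub> ?e \<otimes>\<^bsub>P\<^esub> inv\<^bsub>P\<^esub> ?d")
proof (rule P_eqI)
  let ?v = "\<iota> r (Suc r) v"
  interpret O: group "\<Omega> (Suc r)" using group_\<Omega> by simp
  have v': "?v \<in> carrier (\<Omega> (Suc r))" using \<iota>_closed r v by simp
  have d: "?d \<in> carrier P" and e: "?e \<in> carrier P"
    using diag_closed[of r v] diag_closed[of "Suc r" b] r v b by auto
  show "?l \<in> carrier P" by (rule diag_closed) (use v' b in auto)
  show "?d \<otimes>\<^bsub>P\<^esub> ?e \<otimes>\<^bsub>P\<^esub> inv\<^bsub>P\<^esub> ?d \<in> carrier P" using d e by (intro P.m_closed P.inv_closed)
  fix m :: nat assume m: "1 \<le> m"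
  interpret Om: group "\<Omega> m" using group_\<Omega> m .
  have rhs: "(?d \<otimes>\<^bsub>P\<^esub> ?e \<otimes>\<^bsub>P\<^esub> inv\<^bsub>P\<^esub> ?d) m = ?d m \<otimes>\<^bsub>\<Omega> m\<^esub> ?e m \<otimes>\<^bsub>\<Omega> m\<^esub> inv\<^bsub>\<Omega> m\<^esub> ?d m"
    by (simp only: P_mult[OF m] P_inv[OF m d])
  have dm: "?d m \<in> carrier (\<Omega> m)" using d m by (auto simp: PiE_iff)
  show "?l m = (?d \<otimes>\<^bsub>P\<^esub> ?e \<otimes>\<^bsub>P\<^esub> inv\<^bsub>P\<^esub> ?d) m"
  proof (cases "m < Suc r")
    case True
    then show ?thesis unfolding rhs using dm m by (simp add: diag_coordinate[of _ "Suc r"])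
  next
    case False
    then interpret h: group_hom "\<Omega> (Suc r)" "\<Omega> m" "\<iota> (Suc r) m"
      by (intro \<iota>_group_hom) auto
    have "?d m = \<iota> (Suc r) m ?v"
      using False m r v by (simp add: diag_coordinate \<iota>_comp_le)
    then show ?thesis unfolding rhs using False m v' b by (simp add: diag_coordinate)
  qed
qed

text \<open>
  From level \<open>r\<close> to level \<open>r + 1\<close>: the commutators of \<open>B\<close> give the diagonal copy of \<open>\<phi> (r + 1) B\<close>,
  conjugation with the diagonal copy of \<open>\<Omega> r\<close> extends it to that of \<open>\<Omega> (r + 1)\<close>, and dividing the
  tail above \<open>r\<close> by its first level leaves the tail above \<open>r + 1\<close>.
\<close>
lemma diag_and_tail_in_subgroup:
  assumes perfect: "perfect_group B" and K: "subgroup K P"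
    and diag1: "tel_diag \<Omega> \<iota> 1 ` carrier (\<Omega> 1) \<subseteq> K" and tail1: "tail 1 ` carrier B \<subseteq> K"
    and r: "1 \<le> r"
  shows "tel_diag \<Omega> \<iota> r ` carrier (\<Omega> r) \<subseteq> K \<and> tail r ` carrier B \<subseteq> K"
  using r
proof (induction r rule: dec_induct)
  case base
  show ?case using diag1 tail1 by simp
next
  case (step r)
  then have r: "1 \<le> r" and dK: "\<And>w. w \<in> carrier (\<Omega> r) \<Longrightarrow> tel_diag \<Omega> \<iota> r w \<in> K"
    and tK: "\<And>g. g \<in> carrier B \<Longrightarrow> tail r g \<in> K" by auto
  interpret d: group_hom "\<Omega> (Suc r)" P "tel_diag \<Omega> \<iota> (Suc r)"
    by (rule diag_group_hom) simp
  interpret \<phi>: group_hom B "\<Omega> (Suc r)" "\<phi> (Suc r)" using \<phi>_group_hom r by simp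
  interpret d\<phi>: group_hom B P "tel_diag \<Omega> \<iota> (Suc r) \<circ> \<phi> (Suc r)"
    by (intro group_hom.intro group_B P.is_group)
      (simp only: group_hom_axioms_def hom_compose[OF \<phi>.homh d.homh])
  let ?S = "derived_set B (carrier B)"
  have "(tel_diag \<Omega> \<iota> (Suc r) \<circ> \<phi> (Suc r)) ` ?S \<subseteq> K"
  proof clarify
    fix g h assume g: "g \<in> carrier B" and h: "h \<in> carrier B"
    show "(tel_diag \<Omega> \<iota> (Suc r) \<circ> \<phi> (Suc r)) (g \<otimes>\<^bsub>B\<^esub> h \<otimes>\<^bsub>B\<^esub> inv\<^bsub>B\<^esub> g \<otimes>\<^bsub>B\<^esub> inv\<^bsub>B\<^esub> h) \<in> K"
      unfolding o_def by (rule diag_of_commutator_in_subgroup[OF r K dK tK g h])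
  qed
  then have "generate P ((tel_diag \<Omega> \<iota> (Suc r) \<circ> \<phi> (Suc r)) ` ?S) \<subseteq> K"
    by (rule P.generate_subgroup_incl[OF _ K])
  moreover have "?S \<subseteq> carrier B" by (rule B.derived_set_in_carrier) simp
  moreover have "generate B ?S = carrier B"
    using perfect unfolding perfect_group_def derived_def by blast
  ultimately have "(tel_diag \<Omega> \<iota> (Suc r) \<circ> \<phi> (Suc r)) ` carrier B \<subseteq> K"
    using d\<phi>.generate_img[of ?S] by simp
  then have dB: "tel_diag \<Omega> \<iota> (Suc r) (\<phi> (Suc r) g) \<in> K" if "g \<in> carrier B" for g
    using that by auto
  let ?T = "{h \<otimes>\<^bsub>\<Omega> (Suc r)\<^esub> b \<otimes>\<^bsub>\<Omega> (Suc r)\<^esub> inv\<^bsub>\<Omega> (Suc r)\<^esub> h | h b.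
          h \<in> \<iota> r (Suc r) ` carrier (\<Omega> r) \<and> b \<in> \<phi> (Suc r) ` carrier B}"
  have T: "carrier (\<Omega> (Suc r)) = generate (\<Omega> (Suc r)) ?T"
    using \<Omega>_generated[of "Suc r"] r by simp
  have "tel_diag \<Omega> \<iota> (Suc r) ` ?T \<subseteq> K"
  proof clarify
    fix v g assume v: "v \<in> carrier (\<Omega> r)" and g: "g \<in> carrier B"
    show "tel_diag \<Omega> \<iota> (Suc r) (\<iota> r (Suc r) v \<otimes>\<^bsub>\<Omega> (Suc r)\<^esub> \<phi> (Suc r) g
        \<otimes>\<^bsub>\<Omega> (Suc r)\<^esub> inv\<^bsub>\<Omega> (Suc r)\<^esub> \<iota> r (Suc r) v) \<in> K"
      unfolding diag_conj[OF r v \<phi>.hom_closed[OF g]]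
      by (intro subgroup.m_closed[OF K] subgroup.m_inv_closed[OF K] dK dB v g)
  qed
  then have "generate P (tel_diag \<Omega> \<iota> (Suc r) ` ?T) \<subseteq> K"
    by (rule P.generate_subgroup_incl[OF _ K])
  moreover have "?T \<subseteq> carrier (\<Omega> (Suc r))" using \<iota>_closed r by auto
  ultimately have dO: "tel_diag \<Omega> \<iota> (Suc r) ` carrier (\<Omega> (Suc r)) \<subseteq> K"
    using d.generate_img[of ?T] T by simp
  have "tail (Suc r) g \<in> K" if g: "g \<in> carrier B" for g
  proof -
    let ?d = "tel_diag \<Omega> \<iota> (Suc r) (\<phi> (Suc r) g)"
    have "?d \<in> carrier P" "tail (Suc r) g \<in> carrier P"
      using diag_closed[of "Suc r"] tail_carrier[of "Suc r"] g by auto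
    then have "tail (Suc r) g = inv\<^bsub>P\<^esub> ?d \<otimes>\<^bsub>P\<^esub> tail r g"
      using P.inv_solve_left[of "tail (Suc r) g" ?d "tail r g"] diag_mult_tail[OF r g]
        tail_carrier[OF r g] by blast
    then show ?thesis
      using subgroup.m_closed[OF K subgroup.m_inv_closed[OF K dB[OF g]] tK[OF g]] by (simp only:)
  qed
  with dO show ?case by blast
qed

end

section \<open>The telescope group\<close>

context flexible_telescope
begin

abbreviation K where "K \<equiv> carrier (telescope_group B \<Omega> \<iota> \<phi>)"

lemma generators_in_P:
  "tel_diag \<Omega> \<iota> 1 ` carrier (\<Omega> 1) \<union> tel_tilde \<Omega> \<iota> \<phi> ` carrier B \<subseteq> carrier P"
  using diag_closed[of 1] tail_carrier[of 1] unfolding tail_one by blast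

lemma K_eq: "K = generate P (tel_diag \<Omega> \<iota> 1 ` carrier (\<Omega> 1) \<union> tel_tilde \<Omega> \<iota> \<phi> ` carrier B)"
  using generators_in_P unfolding telescope_group_def carrier_subgroup_generated by (simp only: Int_absorb1)

lemma subgroup_K: "subgroup K P"
  unfolding K_eq by (rule P.generate_is_subgroup[OF generators_in_P])

lemma telescope_group_eq: "telescope_group B \<Omega> \<iota> \<phi> = P\<lparr>carrier := K\<rparr>"
  by (simp add: telescope_group_def subgroup_generated_def)

lemma diag_in_K:
  assumes "perfect_group B" "1 \<le> r" "w \<in> carrier (\<Omega> r)"
  shows "tel_diag \<Omega> \<iota> r w \<in> K"
proof -
  have "tel_diag \<Omega> \<iota> 1 ` carrier (\<Omega> 1) \<subseteq> K" "tail 1 ` carrier B \<subseteq> K"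
    unfolding K_eq by (auto simp: tail_one intro: generate.incl)
  then show ?thesis using diag_and_tail_in_subgroup[OF assms(1) subgroup_K _ _ assms(2)] assms(3) by blast
qed

lemma huge_group_eq:
  assumes "perfect_group B"
  shows "telescope_huge_group B \<Omega> \<iota> \<phi> = telescope_group B \<Omega> \<iota> \<phi>"
proof -
  let ?g = "(\<Union>i\<in>{1..}. tel_diag \<Omega> \<iota> i ` carrier (\<Omega> i)) \<union> tel_tilde \<Omega> \<iota> \<phi> ` carrier B"
  have g: "?g \<subseteq> carrier P" using diag_closed tail_carrier[of 1] unfolding tail_one by blast
  have "?g \<subseteq> K"
    using diag_in_K[OF assms] unfolding K_eq by (auto intro: generate.incl)
  then have "generate P ?g \<subseteq> K" by (rule P.generate_subgroup_incl[OF _ subgroup_K])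
  moreover have "K \<subseteq> generate P ?g" unfolding K_eq by (rule P.mono_generate) auto
  ultimately have "generate P ?g = K" by blast
  then have "telescope_huge_group B \<Omega> \<iota> \<phi> = P\<lparr>carrier := K\<rparr>"
    unfolding telescope_huge_group_def subgroup_generated_def using g by (simp only: Int_absorb1)
  also have "\<dots> = telescope_group B \<Omega> \<iota> \<phi>" by (rule telescope_group_eq[symmetric])
  finally show ?thesis .
qed

text \<open>Each copy of a factor is a quotient of two consecutive diagonals, by \<open>single_eq_diag\<close>.\<close>
lemma sum_in_K:
  assumes "perfect_group B"
  shows "carrier (sum_group {1..} \<Omega>) \<subseteq> K"
proof
  fix x assume "x \<in> carrier (sum_group {1..} \<Omega>)"
  then have x: "x \<in> (\<Pi>\<^sub>E i\<in>{1..}. carrier (\<Omega> i))" "finite {i \<in> {1..}. x i \<noteq> \<one>\<^bsub>\<Omega> i\<^esub>}"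
    using carrier_sum_group[of "{1..}" \<Omega>] group_\<Omega> by auto
  show "x \<in> K"
  proof (rule finite_part_in_subgroup[OF _ subgroup_K x(2) _ _ x(1)])
    show "group (\<Omega> i)" if "i \<in> {1..}" for i using group_\<Omega> that by simp
    fix i w assume "i \<in> {i \<in> {1..}. x i \<noteq> \<one>\<^bsub>\<Omega> i\<^esub>}" and w: "w \<in> carrier (\<Omega> i)"
    then have i: "1 \<le> i" by simp
    show "single {1..} \<Omega> i w \<in> K" unfolding single_eq_diag[OF i w]
      by (intro subgroup.m_closed[OF subgroup_K] subgroup.m_inv_closed[OF subgroup_K] diag_in_K[OF assms] \<iota>_closed)
        (use i w in auto)
  qed auto
qed

lemma telescope_group_finitely_generated:
  assumes B: "finitely_generated_in B (carrier B)" and \<Omega>1: "finitely_generated_in (\<Omega> 1) (carrier (\<Omega> 1))"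
  shows "finitely_generated_in (telescope_group B \<Omega> \<iota> \<phi>) K"
proof -
  obtain S T where S: "finite S" "S \<subseteq> carrier B" "generate B S = carrier B"
    and T: "finite T" "T \<subseteq> carrier (\<Omega> 1)" "generate (\<Omega> 1) T = carrier (\<Omega> 1)"
    using B \<Omega>1 unfolding finitely_generated_in_def by blast
  interpret t: group_hom B P "tail 1" by (rule tail_group_hom) simp
  interpret d: group_hom "\<Omega> 1" P "tel_diag \<Omega> \<iota> 1" by (rule diag_group_hom) simp
  let ?U = "tel_diag \<Omega> \<iota> 1 ` T \<union> tail 1 ` S"
  have UK: "?U \<subseteq> K" unfolding K_eq tail_one using S(2) T(2) by (blast intro: generate.incl)
  have sub: "subgroup (generate P ?U) P"
    by (rule P.generate_is_subgroup) (use UK subgroup.subset[OF subgroup_K] in blast)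
  have "tel_diag \<Omega> \<iota> 1 ` carrier (\<Omega> 1) = generate P (tel_diag \<Omega> \<iota> 1 ` T)"
    using d.generate_img[OF T(2)] T(3) by simp
  also have "\<dots> \<subseteq> generate P ?U" by (rule P.mono_generate) simp
  finally have 1: "tel_diag \<Omega> \<iota> 1 ` carrier (\<Omega> 1) \<subseteq> generate P ?U" .
  have "tail 1 ` carrier B = generate P (tail 1 ` S)"
    using t.generate_img[OF S(2)] S(3) by simp
  also have "\<dots> \<subseteq> generate P ?U" by (rule P.mono_generate) simp
  finally have "K \<subseteq> generate P ?U"
    using 1 unfolding K_eq tail_one by (intro P.generate_subgroup_incl[OF _ sub]) blast
  moreover have "generate P ?U \<subseteq> K" by (rule P.generate_subgroup_incl[OF UK subgroup_K])
  ultimately have "generate (telescope_group B \<Omega> \<iota> \<phi>) ?U = K"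
    using P.generate_consistent[OF UK subgroup_K, folded telescope_group_eq] by blast
  moreover have "finite ?U" using S(1) T(1) by simp
  ultimately show ?thesis
    using UK unfolding finitely_generated_in_def by blast
qed

end

theorem corollary4p2:
  fixes B :: "('b, 'n) monoid_scheme"
    and \<Omega> :: "nat \<Rightarrow> ('a, 'm) monoid_scheme"
    and \<iota> :: "nat \<Rightarrow> nat \<Rightarrow> 'a \<Rightarrow> 'a"
    and \<phi> :: "nat \<Rightarrow> 'b \<Rightarrow> 'a"
    and N :: "(nat \<Rightarrow> 'a) set"
  assumes "finitely_generated_in B (carrier B)"
    and "perfect_group B"
    and "flexible_telescope B \<Omega> \<iota> \<phi>"
    and "\<And>i. 1 \<le> i \<Longrightarrow> finitely_generated_in (\<Omega> i) (carrier (\<Omega> i))"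
    and "\<And>i. 1 \<le> i \<Longrightarrow> simple_grp (\<Omega> i)"
    and "\<And>i. 1 \<le> i \<Longrightarrow> \<not> comm_group (\<Omega> i)"
    and "simple_grp (telescope_head B \<Omega> \<iota> \<phi>)"
    and "subgroup N (telescope_group B \<Omega> \<iota> \<phi>)"
  shows "(N \<lhd> telescope_group B \<Omega> \<iota> \<phi> \<and> finitely_generated_in (telescope_group B \<Omega> \<iota> \<phi>) N)
         \<longleftrightarrow> direct_factor (telescope_group B \<Omega> \<iota> \<phi>) N"
proof -
  interpret flexible_telescope B \<Omega> \<iota> \<phi> by fact
  let ?G = "telescope_group B \<Omega> \<iota> \<phi>"
  interpret S: simple_subproduct "{1..}" \<Omega> K
    by (rule simple_subproduct.intro) (use assms(5,6) subgroup_K sum_in_K[OF assms(2)] in auto)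
  have Q: "simple_grp (?G Mod carrier (sum_group {1..} \<Omega>))"
    using assms(7) unfolding telescope_head_def huge_group_eq[OF assms(2)] .
  show ?thesis
  proof
    assume "N \<lhd> ?G \<and> finitely_generated_in ?G N"
    then show "direct_factor ?G N"
      using S.direct_factor_if_finitely_generated_normal[of N, folded telescope_group_eq] Q by blast
  next
    assume "direct_factor ?G N"
    then obtain M where M: "N \<lhd> ?G" "M \<lhd> ?G" "N \<inter> M = {\<one>\<^bsub>?G\<^esub>}" "N <#>\<^bsub>?G\<^esub> M = carrier ?G"
      unfolding direct_factor_def by blast
    have "group ?G" using M(1) by (simp add: normal_def)
    moreover have "finitely_generated_in ?G (carrier ?G)"
      using telescope_group_finitely_generated assms(1,4) by simp
    ultimately have "finitely_generated_in ?G N"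
      using group.finitely_generated_if_normal_complement[OF _ M(2) assms(8) M(3,4)] by blast
    with M(1) show "N \<lhd> ?G \<and> finitely_generated_in ?G N" by blast
  qed
qed

end
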